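(* Let $|q|<1$ and let $f(-q)=(q;q)_\infty=\prod_{k\ge 1}(1-q^k)$. Set $$P=\frac{f(-q)}{q^{1/24}f(-q^{2})},\qquad Q=\frac{f(-q^{13})}{q^{13/24}f(-q^{26})}.$$ Then $$(PQ)^6+\left(\frac{2}{PQ}\right)^6=\left(\frac{Q}{P}\right)^7-\left(\frac{P}{Q}\right)^7-13\left(\left(\frac{Q}{P}\right)^5-\left(\frac{P}{Q}\right)^5\right)+52\left(\left(\frac{Q}{P}\right)^3-\left(\frac{P}{Q}\right)^3\right)-78\left(\frac{Q}{P}-\frac{P}{Q}\right).$$
   Context: $(a;q)_\infty=\prod_{n\ge0}(1-aq^n)$. Fractional powers of $q$ are taken consistently, e.g. writing $q=e^{2\pi i\tau}$ with $\operatorname{Im}\tau>0$ and $q^r=e^{2\pi i r\tau}$. *)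

theory Defs
  imports "HOL-Analysis.Analysis"
begin

text \<open>The $q$-shifted factorial $(a;q)_\infty$, for $|q| < 1$.\<close>
definition qpoch_inf :: "complex \<Rightarrow> complex \<Rightarrow> complex" where
  "qpoch_inf a q = (\<Prod>n. 1 - a * q ^ n)"

text \<open>Ramanujan's one-variable $f$, normalised as usual by $f(-q) = (q;q)_\infty$.\<close>
definition ramanujan_f :: "complex \<Rightarrow> complex" where
  "ramanujan_f x = qpoch_inf (- x) (- x)"

text \<open>The power $q^r = e^{2 \pi i r \tau}$ of $q = e^{2 \pi i \tau}$; the argument is \<open>\<tau>\<close>
  rather than \<open>q\<close>, so that all fractional powers use the same branch.\<close>
definition nome_pow :: "complex \<Rightarrow> real \<Rightarrow> complex" where
  "nome_pow \<tau> r = exp (2 * of_real pi * \<i> * of_real r * \<tau>)"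

end

theory Submission
  imports Defs "HOL-Complex_Analysis.Complex_Analysis"
begin

text \<open>
  Here \<open>P = f\<^sub>1(2\<tau>)\<close> and \<open>Q = f\<^sub>1(26\<tau>)\<close> for the Weber function \<open>f\<^sub>1\<close>, so the claim is Schlaefli's
  modular equation of degree \<open>13\<close>. Let \<open>F(\<tau>)\<close> be the difference of its two sides, written in
  \<open>f\<^sub>1(\<tau>)\<close> and \<open>f\<^sub>1(13\<tau>)\<close>. The action of \<open>\<tau> \<mapsto> - 1/\<tau>\<close> on the three Weber functions follows from
  Liouville's theorem applied to a quotient of two theta products. It shows that, up to unimodular
  factors, \<open>SL\<^sub>2(\<int>)\<close> permutes the functions \<open>F(m \<sigma>)\<close>, \<open>F(\<sigma> + 1)\<close> with \<open>m \<in> {1, 2}\<close> and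
  \<open>\<sigma> = \<tau>\<close> or \<open>\<sigma> = (\<tau> + 2k)/13\<close>; hence every value of \<open>|F|\<close> is attained on a fixed vertical
  strip bounded away from the real axis. The first four coefficients of the \<open>q\<close>-expansion cancel,
  so \<open>F\<close> vanishes at the cusp, and therefore \<open>|F|\<close> has a maximum. By the maximum modulus
  principle \<open>F\<close> is constant, hence \<open>0\<close>.
\<close>

subsection \<open>Infinite products\<close>

text \<open>All conjugates of \<open>F\<close> are, up to unimodular factors, \<open>F\<close> at
  affine arguments, so one expansion at infinity controls every cusp. Four coefficients suffice
  because in t = q^(1/2) the pole of \<open>F\<close> has order 7/2: once the numerator is O(t^4), a
  factor t^(1/2) remains. The obstacle is the behaviour of (\<tau> + 2k)/13 under inversion when 13
  does not divide k. It seems to call for the multiplier system of the Weber functions, since roots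
  of unity may be dropped from |F| only if those of the two arguments scale all terms of the
  equation compatibly. Explicit words replace the general formula: the matrices that occur lie in
  the theta group generated by \<tau> + 2 and -1/\<tau>, whose generators act by simple rules. Hence
  the shifts by 2k instead of k; as 2 is invertible modulo 13, no line is lost.\<close>

lemma qpoch_inf_convergent:
  fixes a q :: complex
  assumes "norm q < 1"
  shows "convergent_prod (\<lambda>n. 1 - a * q ^ n)"
proof (rule abs_convergent_prod_imp_convergent_prod[OF summable_imp_abs_convergent_prod])
  have "summable (\<lambda>n. norm a * norm q ^ n)"
    using assms by (intro summable_mult summable_geometric) auto
  then show "summable (\<lambda>n. norm (1 - a * q ^ n - 1))"
    by (simp add: norm_mult norm_power)
qed

lemma qpoch_inf_LIMSEQ:
  assumes "norm q < 1"
  shows "(\<lambda>N. \<Prod>n<N. 1 - a * q ^ n) \<longlonglongrightarrow> qpoch_inf a q"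
  using convergent_prod_LIMSEQ[OF qpoch_inf_convergent[OF assms, of a]]
  by (simp add: qpoch_inf_def LIMSEQ_lessThan_iff_atMost)

lemma qpoch_inf_rec:
  assumes "norm q < 1"
  shows "qpoch_inf a q = (1 - a) * qpoch_inf (a * q) q"
proof (rule LIMSEQ_unique)
  show "(\<lambda>N. \<Prod>n<Suc N. 1 - a * q ^ n) \<longlonglongrightarrow> qpoch_inf a q"
    by (rule LIMSEQ_Suc[OF qpoch_inf_LIMSEQ[OF assms]])
  have "(\<lambda>N. (1 - a) * (\<Prod>n<N. 1 - (a * q) * q ^ n)) \<longlonglongrightarrow> (1 - a) * qpoch_inf (a * q) q"
    by (intro tendsto_intros qpoch_inf_LIMSEQ assms)
  then show "(\<lambda>N. \<Prod>n<Suc N. 1 - a * q ^ n) \<longlonglongrightarrow> (1 - a) * qpoch_inf (a * q) q"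
    by (simp only: prod.lessThan_Suc_shift) (simp add: mult.assoc)
qed

lemma qpoch_inf_nonzero:
  assumes "norm q < 1" "\<And>n. a * q ^ n \<noteq> 1"
  shows "qpoch_inf a q \<noteq> 0"
  unfolding qpoch_inf_def using assms
  by (intro prodinf_nonzero qpoch_inf_convergent) auto

lemma qpoch_inf_nonzero':
  assumes "norm q < 1" "norm a < 1"
  shows "qpoch_inf a q \<noteq> 0"
proof (rule qpoch_inf_nonzero[OF assms(1)])
  fix n
  have "norm (a * q ^ n) \<le> norm a * 1"
    unfolding norm_mult norm_power using assms by (intro mult_left_mono power_le_one) auto
  then show "a * q ^ n \<noteq> 1"
    using assms by force
qed

lemma qpoch_inf_mult_minus:
  assumes "norm q < 1"
  shows "qpoch_inf a q * qpoch_inf (- a) q = qpoch_inf (a\<^sup>2) (q\<^sup>2)"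
proof (rule LIMSEQ_unique)
  have q2: "norm (q\<^sup>2) < 1"
    using assms by (simp add: norm_power power_less_one_iff)
  have "(1 - a * q ^ n) * (1 - (- a) * q ^ n) = 1 - a\<^sup>2 * (q\<^sup>2) ^ n" for n
    by (simp add: algebra_simps power2_eq_square power_mult_distrib)
  then have "(\<Prod>n<N. 1 - a * q ^ n) * (\<Prod>n<N. 1 - (- a) * q ^ n) = (\<Prod>n<N. 1 - a\<^sup>2 * (q\<^sup>2) ^ n)" for N
    by (simp flip: prod.distrib)
  moreover have "(\<lambda>N. (\<Prod>n<N. 1 - a * q ^ n) * (\<Prod>n<N. 1 - (- a) * q ^ n))
      \<longlonglongrightarrow> qpoch_inf a q * qpoch_inf (- a) q"
    by (intro tendsto_intros qpoch_inf_LIMSEQ assms)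
  ultimately show "(\<lambda>N. \<Prod>n<N. 1 - a\<^sup>2 * (q\<^sup>2) ^ n) \<longlonglongrightarrow> qpoch_inf a q * qpoch_inf (- a) q"
    by simp
  show "(\<lambda>N. \<Prod>n<N. 1 - a\<^sup>2 * (q\<^sup>2) ^ n) \<longlonglongrightarrow> qpoch_inf (a\<^sup>2) (q\<^sup>2)"
    by (rule qpoch_inf_LIMSEQ[OF q2])
qed

lemma qpoch_inf_even_odd:
  assumes "norm q < 1"
  shows "qpoch_inf a q = qpoch_inf a (q\<^sup>2) * qpoch_inf (a * q) (q\<^sup>2)"
proof (rule LIMSEQ_unique)
  have q2: "norm (q\<^sup>2) < 1"
    using assms by (simp add: norm_power power_less_one_iff)
  show "(\<lambda>N. \<Prod>n<2 * N. 1 - a * q ^ n) \<longlonglongrightarrow> qpoch_inf a q"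
    using LIMSEQ_subseq_LIMSEQ[OF qpoch_inf_LIMSEQ[OF assms], of "\<lambda>n. 2 * n" a]
    by (auto simp: o_def strict_mono_def)
  have "(\<Prod>n<2 * N. 1 - a * q ^ n) =
      (\<Prod>n<N. 1 - a * (q\<^sup>2) ^ n) * (\<Prod>n<N. 1 - (a * q) * (q\<^sup>2) ^ n)" for N
    by (induction N) (simp_all add: mult_ac flip: power_mult)
  moreover have "(\<lambda>N. (\<Prod>n<N. 1 - a * (q\<^sup>2) ^ n) * (\<Prod>n<N. 1 - (a * q) * (q\<^sup>2) ^ n))
      \<longlonglongrightarrow> qpoch_inf a (q\<^sup>2) * qpoch_inf (a * q) (q\<^sup>2)"
    by (intro tendsto_intros qpoch_inf_LIMSEQ q2)
  ultimately show "(\<lambda>N. \<Prod>n<2 * N. 1 - a * q ^ n) \<longlonglongrightarrow> qpoch_inf a (q\<^sup>2) * qpoch_inf (a * q) (q\<^sup>2)"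
    by simp
qed

text \<open>On a closed disc compactness gives |u| <= M and |v| <= r < 1, so the series of M * r^n
  is a majorant. Both arguments may vary: theta products are used in z with fixed base, Weber
  functions in \<tau>.\<close>

lemma holomorphic_qpoch_inf:
  assumes S: "open S" and u: "u holomorphic_on S" and v: "v holomorphic_on S"
    and v1: "\<And>x. x \<in> S \<Longrightarrow> norm (v x) < 1"
  shows "(\<lambda>x. qpoch_inf (u x) (v x)) holomorphic_on S"
proof (rule holomorphic_uniform_sequence[OF S, of "\<lambda>N x. \<Prod>n<N. 1 + - (u x * v x ^ n)"])
  show "(\<lambda>x. \<Prod>n<N. 1 + - (u x * v x ^ n)) holomorphic_on S" for N
    by (intro holomorphic_intros u v)
next
  fix x assume "x \<in> S"
  then obtain d where d: "d > 0" "cball x d \<subseteq> S"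
    using S by (meson open_contains_cball)
  let ?K = "cball x d"
  have cu: "continuous_on ?K u" and cv: "continuous_on ?K v"
    using u v d holomorphic_on_imp_continuous_on continuous_on_subset by blast+
  have "compact (u ` ?K)"
    by (intro compact_continuous_image cu) auto
  then obtain M where M: "\<And>y. y \<in> ?K \<Longrightarrow> norm (u y) \<le> M"
    by (metis bounded_iff compact_imp_bounded imageI)
  have "continuous_on ?K (\<lambda>y. norm (v y))"
    by (intro continuous_intros cv)
  then obtain y0 where y0: "y0 \<in> ?K" "\<And>y. y \<in> ?K \<Longrightarrow> norm (v y) \<le> norm (v y0)"
    using continuous_attains_sup[of ?K "\<lambda>y. norm (v y)"] d by force
  define r where "r = norm (v y0)"
  have r: "0 \<le> r" "r < 1"
    using y0 d v1 unfolding r_def by auto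
  have "uniformly_convergent_on ?K (\<lambda>N y. \<Prod>n<N. 1 + - (u y * v y ^ n))"
  proof (rule Infinite_Products.uniformly_convergent_on_prod)
    show "continuous_on ?K (\<lambda>y. - (u y * v y ^ n))" for n
      by (intro continuous_intros cu cv)
    show "uniformly_convergent_on ?K (\<lambda>N y. \<Sum>n<N. norm (- (u y * v y ^ n)))"
    proof (rule Weierstrass_m_test')
      show "norm (norm (- (u y * v y ^ n))) \<le> M * r ^ n" if "y \<in> ?K" for n y
      proof -
        have "norm (u y) * norm (v y) ^ n \<le> M * r ^ n"
          using M[OF that] y0(2)[OF that] unfolding r_def
          by (intro mult_mono power_mono) (auto intro: order_trans[OF norm_ge_zero])
        then show ?thesis
          by (simp add: norm_mult norm_power)
      qed
      show "summable (\<lambda>n. M * r ^ n)"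
        using r by (intro summable_mult summable_geometric) auto
    qed
  qed auto
  then obtain l where l: "uniform_limit ?K (\<lambda>N y. \<Prod>n<N. 1 + - (u y * v y ^ n)) l sequentially"
    unfolding uniformly_convergent_on_def by blast
  have "l y = qpoch_inf (u y) (v y)" if "y \<in> ?K" for y
  proof (rule LIMSEQ_unique)
    show "(\<lambda>N. \<Prod>n<N. 1 + - (u y * v y ^ n)) \<longlonglongrightarrow> l y"
      by (rule tendsto_uniform_limitI[OF l that])
    show "(\<lambda>N. \<Prod>n<N. 1 + - (u y * v y ^ n)) \<longlonglongrightarrow> qpoch_inf (u y) (v y)"
      using qpoch_inf_LIMSEQ[of "v y" "u y"] v1 d that by auto
  qed
  then have "uniform_limit ?K (\<lambda>N y. \<Prod>n<N. 1 + - (u y * v y ^ n)) (\<lambda>y. qpoch_inf (u y) (v y)) sequentially"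
    using l by (metis (mono_tags, lifting) uniform_limit_cong')
  then show "\<exists>d>0. cball x d \<subseteq> S \<and>
      uniform_limit (cball x d) (\<lambda>N x. \<Prod>n<N. 1 + - (u x * v x ^ n)) (\<lambda>x. qpoch_inf (u x) (v x)) sequentially"
    using d by blast
qed

subsection \<open>Theta functions and the inversion of the modular parameter\<close>

definition e2pi :: "complex \<Rightarrow> complex" where
  "e2pi z = exp (2 * of_real pi * \<i> * z)"

lemma e2pi_add: "e2pi (x + y) = e2pi x * e2pi y"
  by (simp add: e2pi_def distrib_left exp_add)

lemma e2pi_minus: "e2pi (- x) = inverse (e2pi x)"
  by (simp add: e2pi_def exp_minus)

lemma e2pi_diff: "e2pi (x - y) = e2pi x / e2pi y"
  by (simp add: e2pi_def right_diff_distrib exp_diff)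

lemma e2pi_nonzero [simp]: "e2pi x \<noteq> 0"
  by (simp add: e2pi_def)

lemma e2pi_0 [simp]: "e2pi 0 = 1"
  by (simp add: e2pi_def)

lemma e2pi_1 [simp]: "e2pi 1 = 1"
  by (simp add: e2pi_def)

lemma e2pi_half [simp]: "e2pi (1 / 2) = - 1"
  by (simp add: e2pi_def)

lemma e2pi_of_int [simp]: "e2pi (of_int m) = 1"
  by (auto simp: e2pi_def exp_eq_1 intro!: exI[of _ m])

lemma e2pi_power: "e2pi x ^ n = e2pi (of_nat n * x)"
  by (simp add: e2pi_def mult_ac flip: exp_of_nat_mult)

lemma e2pi_eq_1_imp:
  assumes "e2pi z = 1"
  shows "\<exists>m. z = of_int m"
proof -
  obtain m :: int where "- 2 * pi * Im z = 0" "2 * pi * Re z = of_int (2 * m) * pi"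
    using assms by (auto simp: e2pi_def exp_eq_1)
  then have "z = of_int m"
    by (simp add: complex_eq_iff)
  then show ?thesis ..
qed

lemma norm_e2pi: "norm (e2pi z) = exp (- 2 * pi * Im z)"
  by (simp add: e2pi_def)

lemma norm_e2pi_less_1: "Im z > 0 \<Longrightarrow> norm (e2pi z) < 1"
  by (simp add: norm_e2pi)

lemma holomorphic_e2pi [holomorphic_intros]:
  "f holomorphic_on S \<Longrightarrow> (\<lambda>z. e2pi (f z)) holomorphic_on S"
  unfolding e2pi_def by (intro holomorphic_intros)

lemma Im_minus_inverse_pos: "Im \<tau> > 0 \<Longrightarrow> Im (- 1 / \<tau>) > 0"
  by (simp add: Im_divide sum_power2_gt_zero_iff)

text \<open>By the triple product this is Jacobi's theta_3 without the factor (q;q), which does not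
  depend on z. Dropping it affects neither zeros nor quasi-periods.\<close>

definition jtheta :: "complex \<Rightarrow> complex \<Rightarrow> complex" where
  "jtheta z \<tau> = qpoch_inf (- e2pi (\<tau> / 2 + z)) (e2pi \<tau>) * qpoch_inf (- e2pi (\<tau> / 2 - z)) (e2pi \<tau>)"

lemma jtheta_minus: "jtheta (- z) \<tau> = jtheta z \<tau>"
  by (simp add: jtheta_def)

lemma jtheta_plus_1: "jtheta (z + 1) \<tau> = jtheta z \<tau>"
  by (simp add: jtheta_def e2pi_add e2pi_diff diff_add_eq_diff_diff_swap flip: add.assoc)

text \<open>The shift removes one factor from the first product and adds one to the second; the
  exponential is the ratio of these two factors.\<close>

lemma jtheta_plus_tau:
  assumes "Im \<tau> > 0"
  shows "jtheta (z + \<tau>) \<tau> = e2pi (- \<tau> / 2 - z) * jtheta z \<tau>"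
proof -
  note q = norm_e2pi_less_1[OF assms]
  have 1: "qpoch_inf (- e2pi (\<tau> / 2 + z)) (e2pi \<tau>) =
      (1 + e2pi (\<tau> / 2 + z)) * qpoch_inf (- e2pi (\<tau> / 2 + (z + \<tau>))) (e2pi \<tau>)"
    by (subst qpoch_inf_rec[OF q]) (simp add: add.assoc flip: e2pi_add)
  have 2: "qpoch_inf (- e2pi (\<tau> / 2 - (z + \<tau>))) (e2pi \<tau>) =
      (1 + e2pi (\<tau> / 2 - (z + \<tau>))) * qpoch_inf (- e2pi (\<tau> / 2 - z)) (e2pi \<tau>)"
    by (subst qpoch_inf_rec[OF q]) (simp add: algebra_simps flip: e2pi_add)
  have 3: "\<tau> / 2 - (z + \<tau>) = - \<tau> / 2 - z"
    by (simp add: field_simps)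
  have 4: "1 + e2pi (\<tau> / 2 - (z + \<tau>)) = e2pi (- \<tau> / 2 - z) * (1 + e2pi (\<tau> / 2 + z))"
    unfolding 3 by (simp add: distrib_left flip: e2pi_add)
  show ?thesis
    unfolding jtheta_def by (simp only: 1 2 4 mult_ac)
qed

lemma jtheta_zero:
  assumes "jtheta z \<tau> = 0" "Im \<tau> > 0"
  obtains m n :: int where "z = 1 / 2 + \<tau> / 2 + of_int m + of_int n * \<tau>"
proof -
  note q = norm_e2pi_less_1[OF assms(2)]
  have *: "\<exists>n::nat. \<exists>m::int. w + of_nat n * \<tau> = 1 / 2 + of_int m"
    if "qpoch_inf (- e2pi w) (e2pi \<tau>) = 0" for w
  proof -
    have "\<exists>n. - e2pi w * e2pi \<tau> ^ n = 1"
    proof (rule ccontr)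
      assume "\<nexists>n. - e2pi w * e2pi \<tau> ^ n = 1"
      then have "qpoch_inf (- e2pi w) (e2pi \<tau>) \<noteq> 0"
        by (intro qpoch_inf_nonzero[OF q]) blast
      with that show False
        by simp
    qed
    then obtain n where "- e2pi w * e2pi \<tau> ^ n = 1" ..
    then have "e2pi (w + of_nat n * \<tau> - 1 / 2) = 1"
      by (simp add: e2pi_power e2pi_add e2pi_diff)
    from e2pi_eq_1_imp[OF this] obtain m :: int where "w + of_nat n * \<tau> - 1 / 2 = of_int m" ..
    then have "w + of_nat n * \<tau> = 1 / 2 + of_int m"
      by (simp add: algebra_simps)
    then show ?thesis
      by blast
  qed
  consider "qpoch_inf (- e2pi (\<tau> / 2 + z)) (e2pi \<tau>) = 0" | "qpoch_inf (- e2pi (\<tau> / 2 - z)) (e2pi \<tau>) = 0"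
    using assms(1) by (auto simp: jtheta_def)
  then show thesis
  proof cases
    case 1
    from *[OF this] obtain n :: nat and m :: int where "\<tau> / 2 + z + of_nat n * \<tau> = 1 / 2 + of_int m"
      by auto
    then have "z = 1 / 2 + \<tau> / 2 + of_int m + of_int (- int n - 1) * \<tau>"
      by (simp add: algebra_simps)
    then show thesis by (rule that)
  next
    case 2
    from *[OF this] obtain n :: nat and m :: int where "\<tau> / 2 - z + of_nat n * \<tau> = 1 / 2 + of_int m"
      by auto
    then have "z = 1 / 2 + \<tau> / 2 + of_int (- m - 1) + of_int (int n) * \<tau>"
      by (simp add: algebra_simps)
    then show thesis by (rule that)
  qed
qed

lemma holomorphic_jtheta:
  assumes "Im \<tau> > 0" "f holomorphic_on S" "open S"
  shows "(\<lambda>z. jtheta (f z) \<tau>) holomorphic_on S"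
  unfolding jtheta_def
  by (intro holomorphic_intros holomorphic_qpoch_inf assms norm_e2pi_less_1)

lemma jtheta_half_zero: "Im \<tau> > 0 \<Longrightarrow> jtheta (1 / 2 + \<tau> / 2) \<tau> = 0"
  using qpoch_inf_rec[OF norm_e2pi_less_1, of \<tau> "- e2pi (\<tau> / 2 - (1 / 2 + \<tau> / 2))"]
  by (simp add: jtheta_def e2pi_minus)

text \<open>The zero is simple since only one factor of the product vanishes.\<close>
lemma jtheta_simple_zero:
  assumes "Im \<tau> > 0"
  obtains d where "((\<lambda>z. jtheta z \<tau>) has_field_derivative d) (at (1 / 2 + \<tau> / 2))" "d \<noteq> 0"
proof -
  note q = norm_e2pi_less_1[OF assms]
  let ?z0 = "1 / 2 + \<tau> / 2"
  define g where "g z = qpoch_inf (- e2pi (\<tau> / 2 + z)) (e2pi \<tau>) * qpoch_inf (- e2pi (\<tau> / 2 - z) * e2pi \<tau>) (e2pi \<tau>)" for z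
  have eq: "jtheta z \<tau> = (1 + e2pi (\<tau> / 2 - z)) * g z" for z
    unfolding jtheta_def g_def
    by (subst (2) qpoch_inf_rec[OF q]) (simp add: mult_ac)
  have "g holomorphic_on UNIV"
    unfolding g_def by (intro holomorphic_intros holomorphic_qpoch_inf q) auto
  then obtain g' where g': "(g has_field_derivative g') (at ?z0)"
    by (auto simp: holomorphic_on_open)
  have "((\<lambda>z. (1 + e2pi (\<tau> / 2 - z)) * g z) has_field_derivative
      (1 + e2pi (\<tau> / 2 - ?z0)) * g' + (e2pi (\<tau> / 2 - ?z0) * (- 2 * of_real pi * \<i>)) * g ?z0) (at ?z0)"
    unfolding e2pi_def by (rule g' derivative_eq_intros refl)+ (simp add: mult_ac add_ac)
  then have "((\<lambda>z. jtheta z \<tau>) has_field_derivative (2 * of_real pi * \<i>) * g ?z0) (at ?z0)"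
    by (simp add: eq[abs_def] e2pi_minus)
  moreover have "g ?z0 \<noteq> 0"
  proof -
    have "- e2pi (\<tau> / 2 + ?z0) = e2pi \<tau>"
      by (simp add: e2pi_add flip: power2_eq_square)
    moreover have "- e2pi (\<tau> / 2 - ?z0) * e2pi \<tau> = e2pi \<tau>"
      by (simp add: e2pi_minus)
    ultimately show ?thesis
      unfolding g_def using qpoch_inf_nonzero'[OF q q] by simp
  qed
  ultimately show thesis
    using that by simp
qed

lemma periodic_of_int:
  fixes g :: "complex \<Rightarrow> 'a"
  assumes "\<And>z. g (z + p) = g z"
  shows "g (z + of_int m * p) = g z"
proof (induction m arbitrary: z rule: int_induct[where k = 0])
  case (step1 i)
  then show ?case
    using assms[of "z + of_int i * p"] by (simp add: algebra_simps)
next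
  case (step2 i)
  then show ?case
    using assms[of "z + of_int (i - 1) * p"] by (simp add: algebra_simps)
qed simp

lemma doubly_periodic_constant:
  assumes "g holomorphic_on UNIV" "Im \<tau> > 0" "\<And>z. g (z + 1) = g z" "\<And>z. g (z + \<tau>) = g z"
  obtains c where "\<And>z. g z = c"
proof -
  \<comment> \<open>Reducing the imaginary part by multiples of \<tau> first and the real part by
    integers afterwards ends in a rectangle, so no period parallelogram is needed.\<close>
  let ?K = "cbox 0 (Complex 1 (Im \<tau>))"
  have "\<exists>w\<in>?K. g z = g w" for z
  proof -
    define n where "n = \<lfloor>Im z / Im \<tau>\<rfloor>"
    define m where "m = \<lfloor>Re (z - of_int n * \<tau>)\<rfloor>"
    define w where "w = z - of_int n * \<tau> - of_int m"
    have "of_int n \<le> Im z / Im \<tau>" "Im z / Im \<tau> < of_int n + 1"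
      unfolding n_def by linarith+
    then have "0 \<le> Im w" "Im w \<le> Im \<tau>"
      using assms(2) by (simp_all add: w_def field_simps)
    moreover have "of_int m \<le> Re (z - of_int n * \<tau>)" "Re (z - of_int n * \<tau>) < of_int m + 1"
      unfolding m_def by linarith+
    then have "0 \<le> Re w" "Re w \<le> 1"
      by (simp_all add: w_def)
    moreover have "g z = g w"
      using periodic_of_int[of g 1 w m] periodic_of_int[of g \<tau> "w + of_int m" n] assms(3,4)
      by (simp add: w_def)
    ultimately show ?thesis
      by (auto simp: in_cbox_complex_iff)
  qed
  then have "range g \<subseteq> g ` ?K"
    by auto
  moreover have "compact (g ` ?K)"
    using assms(1) by (intro compact_continuous_image compact_cbox)
      (meson continuous_on_subset holomorphic_on_imp_continuous_on subset_UNIV)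
  ultimately have "bounded (range g)"
    using bounded_subset compact_imp_bounded by blast
  from Liouville_theorem[OF assms(1) this] show thesis
    using that by (auto simp: constant_on_def)
qed

text \<open>Both sides have the same quasi-periods and vanish on the same lattice coset, so their
  quotient is elliptic without poles. The constant depends on \<tau> and is determined only later,
  through Weber functions.\<close>

lemma jtheta_inversion:
  assumes \<tau>: "Im \<tau> > 0"
  obtains C where "\<And>z. jtheta (z / \<tau>) (- 1 / \<tau>) = C * e2pi (z\<^sup>2 / (2 * \<tau>)) * jtheta z \<tau>"
proof -
  have \<tau>0: "\<tau> \<noteq> 0"
    using \<tau> by auto
  note \<tau>' = Im_minus_inverse_pos[OF \<tau>]
  define D where "D = (\<lambda>z. jtheta z \<tau>)"
  \<comment> \<open>The Gaussian factor converts the periods 1 and -1/\<tau> of the transformed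
    theta product into the quasi-periods of \<open>D\<close>.\<close>
  define N where "N = (\<lambda>z. jtheta (z / \<tau>) (- 1 / \<tau>) * e2pi (- (z\<^sup>2) / (2 * \<tau>)))"
  define z0 where "z0 = 1 / 2 + \<tau> / 2"
  have holD: "D holomorphic_on S" and holN: "N holomorphic_on S" if "open S" for S
    unfolding D_def N_def using \<tau>0 \<tau>' that
    by (auto intro!: holomorphic_intros holomorphic_jtheta \<tau> \<tau>')
  have D1: "D (z + 1) = D z" and D\<tau>: "D (z + \<tau>) = e2pi (- \<tau> / 2 - z) * D z" for z
    unfolding D_def by (simp_all add: jtheta_plus_1 jtheta_plus_tau[OF \<tau>])
  have N1: "N (z + 1) = N z" for z
  proof -
    have a: "jtheta (z / \<tau>) (- 1 / \<tau>) = e2pi (1 / (2 * \<tau>) - (z + 1) / \<tau>) * jtheta ((z + 1) / \<tau>) (- 1 / \<tau>)"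
      using jtheta_plus_tau[OF \<tau>', of "(z + 1) / \<tau>"] by (simp add: add_divide_distrib)
    have "- (z\<^sup>2) / (2 * \<tau>) + (1 / (2 * \<tau>) - (z + 1) / \<tau>) = - ((z + 1)\<^sup>2) / (2 * \<tau>)"
      using \<tau>0 by (simp add: field_simps power2_eq_square)
    then show ?thesis
      unfolding N_def a by (simp add: mult_ac flip: e2pi_add)
  qed
  have N\<tau>: "N (z + \<tau>) = e2pi (- \<tau> / 2 - z) * N z" for z
  proof -
    have "- ((z + \<tau>)\<^sup>2) / (2 * \<tau>) = - (z\<^sup>2) / (2 * \<tau>) + (- \<tau> / 2 - z)"
      using \<tau>0 by (simp add: field_simps power2_eq_square)
    then have "e2pi (- ((z + \<tau>)\<^sup>2) / (2 * \<tau>)) = e2pi (- (z\<^sup>2) / (2 * \<tau>)) * e2pi (- \<tau> / 2 - z)"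
      by (simp only: e2pi_add)
    moreover have "(z + \<tau>) / \<tau> = z / \<tau> + 1"
      using \<tau>0 by (simp add: field_simps)
    ultimately show ?thesis
      unfolding N_def by (simp add: jtheta_plus_1)
  qed
  have Dz0: "D z0 = 0"
    unfolding D_def z0_def by (rule jtheta_half_zero[OF \<tau>])
  have Nz0: "N z0 = 0"
  proof -
    have "z0 / \<tau> = - (1 / 2 + (- 1 / \<tau>) / 2) + 1"
      using \<tau>0 unfolding z0_def by (simp add: field_simps)
    then have "jtheta (z0 / \<tau>) (- 1 / \<tau>) = 0"
      using jtheta_half_zero[OF \<tau>'] by (simp only: jtheta_plus_1 jtheta_minus)
    then show ?thesis
      by (simp add: N_def)
  qed
  obtain d where d: "(D has_field_derivative d) (at z0)" "d \<noteq> 0"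
    unfolding D_def z0_def by (rule jtheta_simple_zero[OF \<tau>])
  obtain n where n: "(N has_field_derivative n) (at z0)"
    using holN[OF open_UNIV] by (auto simp: holomorphic_on_open)
  define c0 where "c0 = n / d"
  have lim: "((\<lambda>w. N w / D w) \<longlongrightarrow> c0) (at z0)"
    by (rule lhopital_complex_simple[OF n d(1) Nz0 Dz0 d(2)]) (simp add: c0_def)
  have "((\<lambda>w. D w / D w) \<longlongrightarrow> 1) (at z0)"
    by (rule lhopital_complex_simple[OF d(1) d(1) Dz0 Dz0 d(2)]) (simp add: d)
  then have "\<forall>\<^sub>F w in at z0. D w / D w \<noteq> 0"
    by (rule tendsto_imp_eventually_ne) simp
  then have ev: "\<forall>\<^sub>F w in at z0. D w \<noteq> 0"
    by eventually_elim auto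
  \<comment> \<open>The simple zero of \<open>D\<close> makes N/D converge at \<open>z0\<close>;
    periodicity carries the value \<open>c0\<close> to all other zeros.\<close>
  define g where "g = (\<lambda>z. if D z = 0 then c0 else N z / D z)"
  have g1: "g (z + 1) = g z" and g\<tau>: "g (z + \<tau>) = g z" for z
    by (simp_all add: g_def D1 N1 D\<tau> N\<tau>)
  have opn: "open {z. D z \<noteq> 0}"
    using holomorphic_on_imp_continuous_on[OF holD[OF open_UNIV]]
    by (intro open_Collect_neq) auto
  have "(\<lambda>z. N z / D z) holomorphic_on {z. D z \<noteq> 0}"
    by (intro holomorphic_intros holN holD opn) auto
  then have holg: "g holomorphic_on {z. D z \<noteq> 0}"
    by (rule holomorphic_transform) (auto simp: g_def)
  obtain r where r: "r > 0" "\<And>w. w \<in> ball z0 r \<Longrightarrow> w \<noteq> z0 \<Longrightarrow> D w \<noteq> 0"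
    using ev unfolding eventually_at by (auto simp: dist_commute)
  have "g holomorphic_on ball z0 r"
  proof (rule no_isolated_singularity'[where K = "{z0}"])
    show "g holomorphic_on ball z0 r - {z0}"
      by (rule holomorphic_on_subset[OF holg]) (use r in auto)
    have "(g \<longlongrightarrow> c0) (at z0)"
    proof (rule Lim_transform_eventually[OF lim])
      show "\<forall>\<^sub>F w in at z0. N w / D w = g w"
        using ev by eventually_elim (simp add: g_def)
    qed
    then show "(g \<longlongrightarrow> g z) (at z within ball z0 r)" if "z \<in> {z0}" for z
      using that Dz0 by (auto simp: g_def[THEN fun_cong, of z0] intro: tendsto_within_subset)
  qed auto
  then obtain g' where g': "(g has_field_derivative g') (at z0)"
    using r(1) by (meson centre_in_ball holomorphic_on_open open_ball)
  have "g field_differentiable at z" for z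
  proof (cases "D z = 0")
    case False
    then show ?thesis
      using holg opn by (auto simp: holomorphic_on_open field_differentiable_def)
  next
    case True
    then obtain k l :: int where kl: "z = z0 + of_int k + of_int l * \<tau>"
      unfolding D_def z0_def using jtheta_zero[OF _ \<tau>] by blast
    define p where "p = - (of_int k + of_int l * \<tau>)"
    have "g (w + p) = g w" for w
      using periodic_of_int[of g 1 w "- k"] periodic_of_int[of g \<tau> "w - of_int k" "- l"] g1 g\<tau>
      by (simp add: p_def algebra_simps)
    moreover have "(g has_field_derivative g') (at (z + p))"
      using g' by (simp add: kl p_def)
    ultimately have "(g has_field_derivative g') (at z)"
      using DERIV_shift[of g g' z p] by simp
    then show ?thesis
      by (auto simp: field_differentiable_def)
  qed
  then have "g holomorphic_on UNIV"
    by (simp add: holomorphic_on_def field_differentiable_at_within)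
  then obtain C where C: "\<And>z. g z = C"
    using doubly_periodic_constant[OF _ \<tau>] g1 g\<tau> by metis
  \<comment> \<open>At zeros of \<open>D\<close> the function \<open>g\<close> says nothing about
    \<open>N\<close>, so vanishing of \<open>N\<close> there is transported from \<open>z0\<close>
    separately.\<close>
  have eq: "N z = C * D z" for z
  proof (cases "D z = 0")
    case True
    then obtain k l :: int where kl: "z = z0 + of_int k + of_int l * \<tau>"
      unfolding D_def z0_def using jtheta_zero[OF _ \<tau>] by blast
    define E where "E = (\<lambda>z. N z = 0)"
    have "E (z0 + of_int k + of_int l * \<tau>) = E z0"
      using periodic_of_int[of E 1 z0 k] periodic_of_int[of E \<tau> "z0 + of_int k" l]
      by (simp add: E_def N1 N\<tau>)
    then show ?thesis
      using True Nz0 kl by (simp add: E_def)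
  next
    case False
    then show ?thesis
      using C[of z] by (simp add: g_def field_simps)
  qed
  show thesis
  proof (rule that)
    fix z
    have "jtheta (z / \<tau>) (- 1 / \<tau>) = N z * e2pi (z\<^sup>2 / (2 * \<tau>))"
      by (simp add: N_def mult.assoc flip: e2pi_add)
    then show "jtheta (z / \<tau>) (- 1 / \<tau>) = C * e2pi (z\<^sup>2 / (2 * \<tau>)) * jtheta z \<tau>"
      by (simp add: eq D_def mult_ac)
  qed
qed

subsection \<open>Weber functions\<close>

definition weber0 :: "complex \<Rightarrow> complex" where
  "weber0 \<tau> = e2pi (- \<tau> / 48) * qpoch_inf (- e2pi (\<tau> / 2)) (e2pi \<tau>)"

definition weber1 :: "complex \<Rightarrow> complex" where
  "weber1 \<tau> = e2pi (- \<tau> / 48) * qpoch_inf (e2pi (\<tau> / 2)) (e2pi \<tau>)"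

definition weber2 :: "complex \<Rightarrow> complex" where
  "weber2 \<tau> = of_real (sqrt 2) * e2pi (\<tau> / 24) * qpoch_inf (- e2pi \<tau>) (e2pi \<tau>)"

lemma
  assumes "Im \<tau> > 0"
  shows weber0_nonzero: "weber0 \<tau> \<noteq> 0"
    and weber1_nonzero: "weber1 \<tau> \<noteq> 0"
    and weber2_nonzero: "weber2 \<tau> \<noteq> 0"
  using assms unfolding weber0_def weber1_def weber2_def
  by (auto dest!: qpoch_inf_nonzero'[THEN notE, rotated 2] simp: norm_e2pi_less_1)

lemma open_upper_half_plane: "open {\<tau>. Im \<tau> > 0}"
  by (rule open_halfspace_Im_gt)

lemma connected_upper_half_plane: "connected {\<tau>. Im \<tau> > 0}"
  by (simp add: convex_connected convex_halfspace_Im_gt)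

lemma
  shows holomorphic_weber0: "weber0 holomorphic_on {\<tau>. Im \<tau> > 0}"
    and holomorphic_weber1: "weber1 holomorphic_on {\<tau>. Im \<tau> > 0}"
    and holomorphic_weber2: "weber2 holomorphic_on {\<tau>. Im \<tau> > 0}"
  unfolding weber0_def[abs_def] weber1_def[abs_def] weber2_def[abs_def]
  by (auto intro!: holomorphic_intros holomorphic_qpoch_inf open_upper_half_plane norm_e2pi_less_1)

lemma
  shows weber0_plus_1: "weber0 (\<tau> + 1) = e2pi (- 1 / 48) * weber1 \<tau>"
    and weber1_plus_1: "weber1 (\<tau> + 1) = e2pi (- 1 / 48) * weber0 \<tau>"
    and weber2_plus_1: "weber2 (\<tau> + 1) = e2pi (1 / 24) * weber2 \<tau>"
proof -
  have "e2pi (- (\<tau> + 1) / 48) = e2pi (- 1 / 48) * e2pi (- \<tau> / 48)"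
    "e2pi ((\<tau> + 1) / 24) = e2pi (1 / 24) * e2pi (\<tau> / 24)"
    using e2pi_add[of "- 1 / 48" "- \<tau> / 48"] by (simp_all add: add_divide_distrib diff_divide_distrib add.commute flip: e2pi_add)
  moreover have "e2pi ((\<tau> + 1) / 2) = - e2pi (\<tau> / 2)" "e2pi (\<tau> + 1) = e2pi \<tau>"
    by (simp_all add: e2pi_add add_divide_distrib)
  ultimately show "weber0 (\<tau> + 1) = e2pi (- 1 / 48) * weber1 \<tau>"
    "weber1 (\<tau> + 1) = e2pi (- 1 / 48) * weber0 \<tau>" "weber2 (\<tau> + 1) = e2pi (1 / 24) * weber2 \<tau>"
    unfolding weber0_def weber1_def weber2_def by (simp_all only: minus_minus mult_ac)
qed

text \<open>Euler's identity between partitions into odd and into distinct parts: split (q;q) by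
  parity, compare with (q;q)(-q;q) = (q^2;q^2), and cancel.\<close>

lemma qpoch_inf_euler:
  assumes "norm q < 1"
  shows "qpoch_inf q (q\<^sup>2) * qpoch_inf (- q) q = 1"
proof -
  have q2: "norm (q\<^sup>2) < 1"
    using assms by (simp add: norm_power power_less_one_iff)
  have "qpoch_inf (q\<^sup>2) (q\<^sup>2) * (qpoch_inf q (q\<^sup>2) * qpoch_inf (- q) q) = qpoch_inf q q * qpoch_inf (- q) q"
    using qpoch_inf_even_odd[OF assms, of q] by (simp add: power2_eq_square)
  also have "\<dots> = qpoch_inf (q\<^sup>2) (q\<^sup>2)"
    by (rule qpoch_inf_mult_minus[OF assms])
  finally show ?thesis
    using qpoch_inf_nonzero'[OF q2 q2] by simp
qed

lemma weber1_double_mult_weber2: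
  assumes "Im \<tau> > 0"
  shows "weber1 (2 * \<tau>) * weber2 \<tau> = of_real (sqrt 2)"
  using qpoch_inf_euler[OF norm_e2pi_less_1[OF assms]]
  by (simp add: weber1_def weber2_def e2pi_minus e2pi_power field_simps)

lemma weber_mult:
  assumes "Im \<tau> > 0"
  shows "weber0 \<tau> * weber1 \<tau> * weber2 \<tau> = of_real (sqrt 2)"
proof -
  have "weber0 \<tau> * weber1 \<tau> = weber1 (2 * \<tau>)"
    using qpoch_inf_mult_minus[OF norm_e2pi_less_1[OF assms], of "e2pi (\<tau> / 2)"]
    by (simp add: weber0_def weber1_def e2pi_power mult_ac) (simp add: mult.assoc [symmetric] flip: e2pi_add)
  then show ?thesis
    using weber1_double_mult_weber2[OF assms] by simp
qed

text \<open>At 0 and at the half periods the two products coincide or nearly so, which yields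
  squares of the three Weber functions.\<close>

lemma jtheta_0: "jtheta 0 \<tau> = e2pi (\<tau> / 24) * weber0 \<tau> ^ 2"
  by (simp add: jtheta_def weber0_def power_mult_distrib e2pi_power flip: e2pi_add mult.assoc)
    (simp add: power2_eq_square)

lemma jtheta_half: "jtheta (1 / 2) \<tau> = e2pi (\<tau> / 24) * weber1 \<tau> ^ 2"
  by (simp add: jtheta_def weber1_def power_mult_distrib e2pi_power e2pi_diff e2pi_add[of _ "1/2"]
      flip: e2pi_add mult.assoc)
    (simp add: power2_eq_square)

lemma jtheta_half_tau:
  assumes "Im \<tau> > 0"
  shows "jtheta (\<tau> / 2) \<tau> = e2pi (- \<tau> / 12) * weber2 \<tau> ^ 2"
proof -
  have "(of_real (sqrt 2) :: complex)\<^sup>2 = 2"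
    by (simp flip: of_real_power)
  moreover have "qpoch_inf (- 1) (e2pi \<tau>) = 2 * qpoch_inf (- e2pi \<tau>) (e2pi \<tau>)"
    using qpoch_inf_rec[OF norm_e2pi_less_1[OF assms], of "- 1"] by simp
  ultimately show ?thesis
    by (simp add: jtheta_def weber2_def power_mult_distrib e2pi_power)
      (simp add: power2_eq_square mult.assoc [symmetric] flip: e2pi_add)
qed

section \<open>Inversion of the Weber functions\<close>

text \<open>Evaluating the theta inversion at 0, \<tau>/2 and 1/2 gives one common factor
  \<open>D\<close>; the constant product of the three functions forces its cube to be 1.\<close>

lemma weber_inversion_squares:
  assumes \<tau>: "Im \<tau> > 0"
  obtains D where "D ^ 3 = 1" "weber0 (- 1 / \<tau>) ^ 2 = D * weber0 \<tau> ^ 2"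
    "weber1 (- 1 / \<tau>) ^ 2 = D * weber2 \<tau> ^ 2" "weber2 (- 1 / \<tau>) ^ 2 = D * weber1 \<tau> ^ 2"
proof -
  have \<tau>0: "\<tau> \<noteq> 0"
    using \<tau> by auto
  note \<tau>' = Im_minus_inverse_pos[OF \<tau>]
  obtain C where C: "\<And>z. jtheta (z / \<tau>) (- 1 / \<tau>) = C * e2pi (z\<^sup>2 / (2 * \<tau>)) * jtheta z \<tau>"
    using jtheta_inversion[OF \<tau>] by metis
  define D where "D = C * e2pi (\<tau> / 24 + 1 / (24 * \<tau>))"
  have CD: "C = D * e2pi (- (\<tau> / 24) - 1 / (24 * \<tau>))"
    by (simp add: D_def mult.assoc flip: e2pi_add)
  have cancel: "X = Y" if "e2pi a * X = e2pi b * Y" "a = b" for X Y a b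
    using that by simp
  have 0: "weber0 (- 1 / \<tau>) ^ 2 = D * weber0 \<tau> ^ 2"
  proof (rule cancel)
    show "e2pi ((- 1 / \<tau>) / 24) * weber0 (- 1 / \<tau>) ^ 2 =
        e2pi (- (\<tau> / 24) - 1 / (24 * \<tau>) + \<tau> / 24) * (D * weber0 \<tau> ^ 2)"
      using C[of 0] unfolding e2pi_add by (simp add: jtheta_0 CD mult_ac)
  qed (use \<tau>0 in \<open>simp add: field_simps\<close>)
  have 1: "weber1 (- 1 / \<tau>) ^ 2 = D * weber2 \<tau> ^ 2"
  proof (rule cancel)
    show "e2pi ((- 1 / \<tau>) / 24) * weber1 (- 1 / \<tau>) ^ 2 =
        e2pi (- (\<tau> / 24) - 1 / (24 * \<tau>) + (\<tau> / 2)\<^sup>2 / (2 * \<tau>) + (- \<tau> / 12)) * (D * weber2 \<tau> ^ 2)"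
      using C[of "\<tau> / 2"] \<tau>0 jtheta_half_tau[OF \<tau>] unfolding e2pi_add
      by (simp add: jtheta_half CD mult_ac)
  qed (use \<tau>0 in \<open>simp add: field_simps power2_eq_square\<close>)
  have 2: "weber2 (- 1 / \<tau>) ^ 2 = D * weber1 \<tau> ^ 2"
  proof (rule cancel)
    \<comment> \<open>The point 1/(2\<tau>) is minus the half period of the new parameter -1/\<tau>,
      and theta is even.\<close>
    have "jtheta ((1 / 2) / \<tau>) (- 1 / \<tau>) = jtheta ((- 1 / \<tau>) / 2) (- 1 / \<tau>)"
      using jtheta_minus[of "(1 / 2) / \<tau>"] by (simp add: mult.commute)
    then show "e2pi (- (- 1 / \<tau>) / 12) * weber2 (- 1 / \<tau>) ^ 2 =
        e2pi (- (\<tau> / 24) - 1 / (24 * \<tau>) + (1 / 2)\<^sup>2 / (2 * \<tau>) + \<tau> / 24) * (D * weber1 \<tau> ^ 2)"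
      using C[of "1 / 2"] jtheta_half_tau[OF \<tau>'] unfolding e2pi_add
      by (simp add: jtheta_half CD mult_ac)
  qed (use \<tau>0 in \<open>simp add: field_simps power2_eq_square\<close>)
  have "(weber0 (- 1 / \<tau>) * weber1 (- 1 / \<tau>) * weber2 (- 1 / \<tau>))\<^sup>2 =
      D ^ 3 * (weber0 \<tau> * weber1 \<tau> * weber2 \<tau>)\<^sup>2"
    by (simp only: power_mult_distrib 0 1 2) (simp add: power3_eq_cube mult_ac)
  then have "D ^ 3 = 1"
    unfolding weber_mult[OF \<tau>] weber_mult[OF \<tau>'] by simp
  from this 0 1 2 show thesis
    by (rule that)
qed

lemma holomorphic_compose_inversion:
  assumes "f holomorphic_on {\<tau>. Im \<tau> > 0}"
  shows "(\<lambda>\<tau>. f (- 1 / \<tau>)) holomorphic_on {\<tau>. Im \<tau> > 0}"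
proof -
  have "f \<circ> (\<lambda>\<tau>. - 1 / \<tau>) holomorphic_on {\<tau>. Im \<tau> > 0}"
    by (intro holomorphic_on_compose_gen[OF _ assms] holomorphic_intros)
      (use Im_minus_inverse_pos in auto)
  then show ?thesis
    by (simp add: o_def)
qed

text \<open>Finite range and connectedness; this removes the ambiguity left by knowing only
  squares.\<close>

lemma root_of_unity_valued_constant:
  fixes f :: "complex \<Rightarrow> complex"
  assumes "connected S" "continuous_on S f" "\<And>x. x \<in> S \<Longrightarrow> f x ^ n = 1" "n > 0" "x \<in> S" "y \<in> S"
  shows "f x = f y"
proof -
  have "finite {z::complex. z ^ n = 1}"
    by (rule finite_roots_unity) (use assms(4) in simp)
  then have "finite (f ` S)"
    by (rule rev_finite_subset) (use assms(3) in auto)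
  then have "f constant_on S"
    using continuous_finite_range_constant[OF assms(1,2)] by blast
  then show ?thesis
    using assms(5,6) by (auto simp: constant_on_def)
qed

text \<open>The quotient is a sixth root of unity, hence constant, and equals 1 at the fixed point
  \<open>\<i>\<close> of the inversion.\<close>

lemma weber0_inversion:
  assumes \<tau>: "Im \<tau> > 0"
  shows "weber0 (- 1 / \<tau>) = weber0 \<tau>"
proof -
  let ?f = "\<lambda>\<tau>. weber0 (- 1 / \<tau>) / weber0 \<tau>"
  have "?f \<tau> = ?f \<i>"
  proof (rule root_of_unity_valued_constant[of "{\<tau>. Im \<tau> > 0}" ?f 6])
    show "continuous_on {\<tau>. Im \<tau> > 0} ?f"
      by (intro continuous_intros holomorphic_on_imp_continuous_on holomorphic_weber0
            holomorphic_compose_inversion) (auto simp: weber0_nonzero)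
    show "?f z ^ 6 = 1" if z: "z \<in> {\<tau>. Im \<tau> > 0}" for z
    proof -
      have z': "Im z > 0"
        using z by simp
      from weber_inversion_squares[OF this] obtain D where D: "D ^ 3 = 1" "weber0 (- 1 / z) ^ 2 = D * weber0 z ^ 2"
        by blast
      have "?f z ^ 6 = ((?f z)\<^sup>2) ^ 3"
        by (simp flip: power_mult)
      also have "(?f z)\<^sup>2 = D"
        unfolding power_divide D(2) using weber0_nonzero[OF z'] by simp
      finally show ?thesis
        using D by simp
    qed
  qed (use \<tau> connected_upper_half_plane in auto)
  then show ?thesis
    using weber0_nonzero[of \<i>] weber0_nonzero[OF \<tau>] by (simp add: divide_eq_eq)
qed

text \<open>Serves to fix a sign at \<open>\<i>\<close>, where the Weber functions are positive
  reals.\<close>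

lemma qpoch_inf_of_real_pos:
  assumes "0 \<le> q" "q < 1" "a < 1"
  obtains r where "r > 0" "qpoch_inf (of_real a) (of_real q) = of_real r"
proof -
  have conv: "convergent_prod (\<lambda>n. 1 - a * q ^ n)"
  proof (rule abs_convergent_prod_imp_convergent_prod[OF summable_imp_abs_convergent_prod])
    show "summable (\<lambda>n. norm (1 - a * q ^ n - 1))"
      using assms by (simp add: norm_mult norm_power abs_mult power_abs summable_mult summable_geometric)
  qed
  have "a * q ^ n < 1" for n
  proof (cases "a \<le> 0")
    case True
    then show ?thesis
      using assms by (smt (verit) mult_nonneg_nonneg mult_minus_left zero_le_power)
  next
    case False
    then have "a * q ^ n \<le> a * 1"
      using assms by (intro mult_left_mono power_le_one) auto
    then show ?thesis
      using assms by simp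
  qed
  then have "prodinf (\<lambda>n. 1 - a * q ^ n) > 0"
    by (intro less_0_prodinf conv) simp
  moreover have "(\<lambda>n. complex_of_real (1 - a * q ^ n)) has_prod of_real (prodinf (\<lambda>n. 1 - a * q ^ n))"
    using conv by (simp only: has_prod_of_real_iff convergent_prod_has_prod)
  then have "qpoch_inf (of_real a) (of_real q) = of_real (prodinf (\<lambda>n. 1 - a * q ^ n))"
    unfolding qpoch_inf_def using has_prod_unique by fastforce
  ultimately show thesis
    by (rule that)
qed

text \<open>The case of \<open>weber0\<close> gives D = 1, so the quotient is a constant sign;
  positivity at \<open>\<i>\<close> decides it.\<close>

lemma weber1_inversion:
  assumes \<tau>: "Im \<tau> > 0"
  shows "weber1 (- 1 / \<tau>) = weber2 \<tau>"
proof -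
  let ?f = "\<lambda>\<tau>. weber1 (- 1 / \<tau>) / weber2 \<tau>"
  have sq: "(?f z)\<^sup>2 = 1" if z: "Im z > 0" for z
  proof -
    obtain D where D: "weber0 (- 1 / z) ^ 2 = D * weber0 z ^ 2" "weber1 (- 1 / z) ^ 2 = D * weber2 z ^ 2"
      by (rule weber_inversion_squares[OF z])
    from D(1) have "D = 1"
      using weber0_inversion[OF z] weber0_nonzero[OF z] by simp
    then show ?thesis
      using D(2) weber2_nonzero[OF z] by (simp add: power_divide)
  qed
  have "?f \<tau> = ?f \<i>"
  proof (rule root_of_unity_valued_constant[of "{\<tau>. Im \<tau> > 0}" ?f 2])
    show "continuous_on {\<tau>. Im \<tau> > 0} ?f"
      by (intro continuous_intros holomorphic_on_imp_continuous_on holomorphic_weber1 holomorphic_weber2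
            holomorphic_compose_inversion) (auto simp: weber2_nonzero)
  qed (use \<tau> sq connected_upper_half_plane in auto)
  also have "\<dots> = 1"
  proof -
    have e: "e2pi (of_real x * \<i>) = of_real (exp (- 2 * pi * x))" for x
    proof -
      have "2 * of_real pi * \<i> * (of_real x * \<i>) = complex_of_real (- 2 * pi * x)"
        by (simp add: mult.assoc)
      then show ?thesis
        unfolding e2pi_def by (simp only: exp_of_real)
    qed
    obtain r s where r: "r > 0" "qpoch_inf (of_real (exp (- 2 * pi * (1 / 2)))) (of_real (exp (- 2 * pi * 1))) = of_real r"
      and s: "s > 0" "qpoch_inf (of_real (- exp (- 2 * pi * 1))) (of_real (exp (- 2 * pi * 1))) = of_real s"
    proof -
      have e1: "0 < exp (- 2 * pi * 1)" "exp (- 2 * pi * 1) < 1" "exp (- 2 * pi * (1 / 2)) < 1"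
        by simp_all
      obtain r where r: "r > 0" "qpoch_inf (of_real (exp (- 2 * pi * (1 / 2)))) (of_real (exp (- 2 * pi * 1))) = of_real r"
        by (rule qpoch_inf_of_real_pos[of "exp (- 2 * pi * 1)" "exp (- 2 * pi * (1 / 2))"]) (use e1 in linarith)+
      obtain s where s: "s > 0" "qpoch_inf (of_real (- exp (- 2 * pi * 1))) (of_real (exp (- 2 * pi * 1))) = of_real s"
        by (rule qpoch_inf_of_real_pos[of "exp (- 2 * pi * 1)" "- exp (- 2 * pi * 1)"])
          (use e1 in linarith)+
      show thesis
        by (rule that[OF r s])
    qed
    have "weber1 \<i> = of_real (exp (- 2 * pi * (- 1 / 48)) * r)"
      using r(2) e[of "- 1 / 48"] e[of "1 / 2"] e[of 1] by (simp add: weber1_def)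
    moreover have "weber2 \<i> = of_real (sqrt 2 * exp (- 2 * pi * (1 / 24)) * s)"
      using s(2) e[of "1 / 24"] e[of 1] by (simp add: weber2_def)
    ultimately obtain x where x: "x > 0" "?f \<i> = of_real x"
      using r(1) s(1)
      by (intro that[of "exp (- 2 * pi * (- 1 / 48)) * r / (sqrt 2 * exp (- 2 * pi * (1 / 24)) * s)"]) auto
    have "x\<^sup>2 = 1"
      using sq[of \<i>] unfolding x(2) by (simp flip: of_real_power)
    then show ?thesis
      using x by (simp add: power2_eq_1_iff)
  qed
  finally show ?thesis
    using weber2_nonzero[OF \<tau>] by simp
qed

lemma weber2_inversion:
  assumes "Im \<tau> > 0"
  shows "weber2 (- 1 / \<tau>) = weber1 \<tau>"
  using weber1_inversion[OF Im_minus_inverse_pos[OF assms]] by simp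

subsection \<open>The modular relations\<close>

text \<open>The right-hand side of the theorem at t = Q/P. The adjectives odd and even refer to t ->
  1/t; as functions of t both parts are odd, and t -> -i t exchanges them up to a factor i.\<close>

definition odd_part :: "complex \<Rightarrow> complex" where
  "odd_part t = t ^ 7 - (1 / t) ^ 7 - 13 * (t ^ 5 - (1 / t) ^ 5) + 52 * (t ^ 3 - (1 / t) ^ 3) - 78 * (t - 1 / t)"

definition even_part :: "complex \<Rightarrow> complex" where
  "even_part t = t ^ 7 + (1 / t) ^ 7 + 13 * (t ^ 5 + (1 / t) ^ 5) + 52 * (t ^ 3 + (1 / t) ^ 3) + 78 * (t + 1 / t)"

text \<open>Schlaefli's modular equation of degree \<open>13\<close> for the Weber functions \<open>f\<close>, \<open>f\<^sub>1\<close>, \<open>f\<^sub>2\<close>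
  (in this order); the one to be proved has \<open>i = 1\<close>. Indices above \<open>2\<close> behave like \<open>2\<close>.\<close>
definition schlaefli :: "nat \<Rightarrow> complex \<Rightarrow> complex \<Rightarrow> complex" where
  "schlaefli i x y =
    (if i = 0 then (x * y) ^ 6 - 64 / (x * y) ^ 6 - even_part (y / x)
     else if i = 1 then (x * y) ^ 6 + 64 / (x * y) ^ 6 - odd_part (y / x)
     else (x * y) ^ 6 + 64 / (x * y) ^ 6 + odd_part (y / x))"

definition weber :: "nat \<Rightarrow> complex \<Rightarrow> complex" where
  "weber i = (if i = 0 then weber0 else if i = 1 then weber1 else weber2)"

definition schlaefli_norm :: "nat \<Rightarrow> complex \<Rightarrow> real" where
  "schlaefli_norm i \<tau> = norm (schlaefli i (weber i \<tau>) (weber i (13 * \<tau>)))"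

definition inversion_index :: "nat \<Rightarrow> nat" where
  "inversion_index i = (if i = 0 then 0 else if i = 1 then 2 else 1)"

definition shift_index :: "nat \<Rightarrow> nat" where
  "shift_index i = (if i = 0 then 1 else if i = 1 then 0 else i)"

lemma odd_part_uminus: "odd_part (- t) = - odd_part t"
  by (simp add: odd_part_def algebra_simps)

lemma even_part_uminus: "even_part (- t) = - even_part t"
  by (simp add: even_part_def algebra_simps)

lemma odd_part_inverse: "odd_part (1 / t) = - odd_part t"
  by (simp add: odd_part_def algebra_simps)

lemma even_part_inverse: "even_part (1 / t) = even_part t"
  by (simp add: even_part_def algebra_simps)

lemma odd_part_i: "odd_part (- \<i> * t) = \<i> * even_part t"
proof -
  have *: "1 / (- \<i> * t) = \<i> * (1 / t)"
    by (cases "t = 0") (simp_all add: field_simps)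
  show ?thesis
    unfolding odd_part_def even_part_def * power_mult_distrib
    by (simp add: power_numeral_reduce algebra_simps)
qed

lemma even_part_i: "even_part (- \<i> * t) = \<i> * odd_part t"
proof -
  have *: "1 / (- \<i> * t) = \<i> * (1 / t)"
    by (cases "t = 0") (simp_all add: field_simps)
  show ?thesis
    unfolding odd_part_def even_part_def * power_mult_distrib
    by (simp add: power_numeral_reduce algebra_simps)
qed

text \<open>The sign that \<open>odd_part\<close> acquires under t -> 1/t is the sign distinguishing
  the relations for indices 1 and 2.\<close>

lemma schlaefli_swap: "schlaefli (inversion_index i) y x = schlaefli i x y"
  using odd_part_inverse[of "y / x"] even_part_inverse[of "y / x"]
  by (auto simp: schlaefli_def inversion_index_def mult.commute)

lemma scaled_args:
  fixes \<alpha> \<beta> x y :: complex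
  shows "(\<alpha> * x) * (\<beta> * y) = (\<alpha> * \<beta>) * (x * y)" "(\<beta> * y) / (\<alpha> * x) = (\<beta> / \<alpha>) * (y / x)"
  by simp_all

lemma schlaefli_scale:
  assumes "\<beta> / \<alpha> = c" "(\<alpha> * \<beta>) ^ 6 = c" "c = 1 \<or> c = - 1"
  shows "schlaefli i (\<alpha> * x) (\<beta> * y) = c * schlaefli i x y"
  unfolding schlaefli_def scaled_args(1)[of \<alpha> x \<beta> y] scaled_args(2)[of \<beta> y \<alpha> x] assms(1,2) power_mult_distrib[of "\<alpha> * \<beta>"]
  using assms(3) by (auto simp: odd_part_uminus even_part_uminus)

text \<open>The extra sign falls on \<open>odd_part\<close> alone and so turns the relation for
  index 1 into that for index 2 and back.\<close>

lemma schlaefli_scale_minus: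
  assumes "\<beta> / \<alpha> = - c" "(\<alpha> * \<beta>) ^ 6 = c" "c = 1 \<or> c = - 1" "i > 0"
  shows "schlaefli i (\<alpha> * x) (\<beta> * y) = c * schlaefli (inversion_index i) x y"
  unfolding schlaefli_def scaled_args(1)[of \<alpha> x \<beta> y] scaled_args(2)[of \<beta> y \<alpha> x] assms(1,2) power_mult_distrib[of "\<alpha> * \<beta>"]
  using assms(3,4) by (auto simp: inversion_index_def odd_part_uminus even_part_uminus)

text \<open>Since 1/i = -i, the term with 64 changes sign relative to the first one, just as
  \<open>odd_part\<close> and \<open>even_part\<close> are exchanged.\<close>

lemma schlaefli_scale_i:
  assumes "\<beta> / \<alpha> = - \<i>" "(\<alpha> * \<beta>) ^ 6 = \<i>" "i = 0 \<or> i = 1"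
  shows "schlaefli i (\<alpha> * x) (\<beta> * y) = \<i> * schlaefli (shift_index i) x y"
proof -
  have *: "64 / (\<i> * t) = - (\<i> * (64 / t))" for t :: complex
    by (cases "t = 0") (simp_all add: field_simps)
  show ?thesis
    unfolding schlaefli_def scaled_args(1)[of \<alpha> x \<beta> y] scaled_args(2)[of \<beta> y \<alpha> x] assms(1,2) power_mult_distrib[of "\<alpha> * \<beta>"]
      * odd_part_i even_part_i
    using assms(3) by (auto simp: shift_index_def algebra_simps)
qed

lemma e2pi_quarter: "e2pi (1 / 4) = \<i>"
proof -
  have "e2pi (1 / 4) = cis (pi / 2)"
    by (simp add: e2pi_def cis_conv_exp mult_ac)
  then show ?thesis
    by simp
qed

lemma e2pi_eqI:
  assumes "x = y + of_int m"
  shows "e2pi x = e2pi y"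
  using assms by (simp add: e2pi_add)

text \<open>With multiplier \<open>e2pi c\<close> per unit shift, the ratio y/x gains
  \<open>e2pi (12 * c)\<close> and (x y)^6 gains \<open>e2pi (84 * c)\<close>. For c = 1/24 these
  are -1 and -1, for c = -1/48 they are -i and i.\<close>

lemma schlaefli_norm_plus_1: "schlaefli_norm i (\<tau> + 1) = schlaefli_norm (shift_index i) \<tau>"
proof -
  have shift13: "weber i (13 * (\<tau> + 1)) = e2pi (13 * c) * weber (shift_index i) (13 * \<tau>)"
    if "\<And>\<tau>. weber i (\<tau> + 1) = e2pi c * weber (shift_index i) \<tau>"
      "\<And>\<tau>. weber (shift_index i) (\<tau> + 1) = e2pi c * weber i \<tau>" for c
  proof -
    \<comment> \<open>Two unit shifts restore the index, so 13 = 2 * 6 + 1 shifts change it exactly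
      once.\<close>
    have 2: "weber i (\<tau> + of_nat (2 * n)) = e2pi (of_nat (2 * n) * c) * weber i \<tau>" for n \<tau>
    proof (induction n)
      case (Suc n)
      have "\<tau> + of_nat (2 * Suc n) = (\<tau> + of_nat (2 * n) + 1) + 1"
        by simp
      then show ?case
        by (simp only: that Suc) (simp add: algebra_simps flip: e2pi_add)
    qed simp
    have "weber i (13 * (\<tau> + 1)) = weber i ((13 * \<tau> + of_nat (2 * 6)) + 1)"
      by (simp add: algebra_simps)
    also have "\<dots> = e2pi (of_nat (2 * 6) * c) * weber i (13 * \<tau> + 1)"
      using 2[of "13 * \<tau> + 1" 6] by (simp add: algebra_simps)
    also have "\<dots> = e2pi (13 * c) * weber (shift_index i) (13 * \<tau>)"
      by (simp only: that) (simp add: algebra_simps flip: e2pi_add mult.assoc)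
    finally show ?thesis .
  qed
  show ?thesis
  proof (cases "i > 1")
    case i: True
    let ?c = "1 / 24 :: complex"
    have s: "weber i (\<tau> + 1) = e2pi ?c * weber (shift_index i) \<tau>"
      "weber (shift_index i) (\<tau> + 1) = e2pi ?c * weber i \<tau>" for \<tau>
      using i by (auto simp: weber_def shift_index_def weber2_plus_1)
    have "e2pi (13 * ?c) / e2pi ?c = - 1"
      by (simp flip: e2pi_diff)
    moreover have "(e2pi ?c * e2pi (13 * ?c)) ^ 6 = - 1"
      using e2pi_eqI[of "7 / 2" "1 / 2" 3] by (simp add: e2pi_power flip: e2pi_add)
    ultimately show ?thesis
      unfolding schlaefli_norm_def s(1) shift13[OF s] using i
      by (simp add: schlaefli_scale norm_mult shift_index_def)
  next
    case False
    then have i: "i = 0 \<or> i = 1"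
      by auto
    let ?c = "- 1 / 48 :: complex"
    have s: "weber i (\<tau> + 1) = e2pi ?c * weber (shift_index i) \<tau>"
      "weber (shift_index i) (\<tau> + 1) = e2pi ?c * weber i \<tau>" for \<tau>
      using i by (auto simp: weber_def shift_index_def weber0_plus_1 weber1_plus_1)
    have "e2pi (13 * ?c) / e2pi ?c = e2pi (- (1 / 4))"
      by (simp flip: e2pi_diff)
    also have "\<dots> = - \<i>"
      by (simp add: e2pi_minus e2pi_quarter)
    finally have "e2pi (13 * ?c) / e2pi ?c = - \<i>" .
    moreover have "(e2pi ?c * e2pi (13 * ?c)) ^ 6 = \<i>"
      using e2pi_eqI[of "- 7 / 4" "1 / 4" "- 2"] by (simp add: e2pi_power e2pi_quarter flip: e2pi_add)
    ultimately show ?thesis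
      unfolding schlaefli_norm_def s(1) shift13[OF s]
      by (simp add: schlaefli_scale_i[OF _ _ i] norm_mult)
  qed
qed

lemma shift_index_idem [simp]: "shift_index (shift_index i) = i"
  by (simp add: shift_index_def)

lemma schlaefli_norm_plus_even: "schlaefli_norm i (\<tau> + 2 * of_int m) = schlaefli_norm i \<tau>"
proof -
  have "schlaefli_norm i (\<tau> + 2) = schlaefli_norm i \<tau>" for \<tau>
    using schlaefli_norm_plus_1[of i "\<tau> + 1"] schlaefli_norm_plus_1[of "shift_index i" \<tau>]
    by (simp add: add.assoc)
  from periodic_of_int[of "schlaefli_norm i", OF this] show ?thesis
    by (simp add: mult.commute)
qed

section \<open>Inversion of the lines modulo 13 by words in the theta group\<close>

lemma weber_inversion: "Im \<tau> > 0 \<Longrightarrow> weber i (- 1 / \<tau>) = weber (inversion_index i) \<tau>"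
  using weber0_inversion weber1_inversion weber2_inversion by (simp add: weber_def inversion_index_def)

text \<open>The Fricke involution: 13 times the new argument is -1/\<tau>, so the two Weber values
  change places.\<close>

lemma schlaefli_norm_inversion:
  assumes "Im \<tau> > 0"
  shows "schlaefli_norm i (- 1 / (13 * \<tau>)) = schlaefli_norm (inversion_index i) \<tau>"
proof -
  have "Im (13 * \<tau>) > 0"
    using assms by simp
  from weber_inversion[OF this] weber_inversion[OF assms] show ?thesis
    unfolding schlaefli_norm_def by (simp add: schlaefli_swap[of i, symmetric])
qed

text \<open>The exponent of \<open>e2pi (1 / 24)\<close> that \<open>weber i\<close> picks up under \<open>\<tau> \<mapsto> \<tau> + 2\<close>.\<close>
definition even_shift_exponent :: "nat \<Rightarrow> int" where
  "even_shift_exponent i = (if i = 0 \<or> i = 1 then - 1 else 2)"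

lemma weber_even_shift:
  "weber i (2 * of_int a + \<tau>) = e2pi (of_int (even_shift_exponent i * a) / 24) * weber i \<tau>"
proof -
  have "e2pi (- (2 * of_int a + \<tau>) / 48) = e2pi (of_int (- a) / 24) * e2pi (- \<tau> / 48)"
    "e2pi ((2 * of_int a + \<tau>) / 24) = e2pi (of_int (2 * a) / 24) * e2pi (\<tau> / 24)"
    by (simp_all add: field_simps flip: e2pi_add)
  moreover have "e2pi ((2 * of_int a + \<tau>) / 2) = e2pi (\<tau> / 2)" "e2pi (2 * of_int a + \<tau>) = e2pi \<tau>"
    using e2pi_eqI[of "(2 * of_int a + \<tau>) / 2" "\<tau> / 2" a] e2pi_eqI[of "2 * of_int a + \<tau>" \<tau> "2 * a"]
    by (simp_all add: field_simps)
  ultimately show ?thesis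
    by (auto simp: weber_def even_shift_exponent_def weber0_def weber1_def weber2_def)
qed

text \<open>Even continued fractions describe the words in \<open>\<tau> \<mapsto> \<tau> + 2\<close> and
  \<open>\<tau> \<mapsto> - 1 / \<tau>\<close>.\<close>
fun even_cf :: "int list \<Rightarrow> complex \<Rightarrow> complex" where
  "even_cf [] z = z"
| "even_cf (a # as) z = 2 * of_int a + (- 1 / even_cf as z)"

fun even_cf_index :: "int list \<Rightarrow> nat \<Rightarrow> nat" where
  "even_cf_index [] i = i"
| "even_cf_index (a # as) i = even_cf_index as (inversion_index i)"

fun even_cf_exponent :: "int list \<Rightarrow> nat \<Rightarrow> int" where
  "even_cf_exponent [] i = 0"
| "even_cf_exponent (a # as) i = even_shift_exponent i * a + even_cf_exponent as (inversion_index i)"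

text \<open>The matrix rows in order; a head \<open>a\<close> multiplies on the left by the matrix
  (2a, -1; 1, 0) of z -> 2a - 1/z.\<close>

fun even_cf_matrix :: "int list \<Rightarrow> int \<times> int \<times> int \<times> int" where
  "even_cf_matrix [] = (1, 0, 0, 1)"
| "even_cf_matrix (a # as) = (case even_cf_matrix as of (p, q, r, s) \<Rightarrow> (2 * a * p - r, 2 * a * q - s, p, q))"

lemma Im_even_cf_pos: "Im z > 0 \<Longrightarrow> Im (even_cf as z) > 0"
  by (induction as) (use Im_minus_inverse_pos in auto)

lemma weber_even_cf:
  "Im z > 0 \<Longrightarrow> weber i (even_cf as z) =
     e2pi (of_int (even_cf_exponent as i) / 24) * weber (even_cf_index as i) z"
proof (induction as arbitrary: i)
  case (Cons a as)
  have "weber i (even_cf (a # as) z) =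
      e2pi (of_int (even_shift_exponent i * a) / 24) * weber (inversion_index i) (even_cf as z)"
    using weber_inversion[OF Im_even_cf_pos[OF Cons.prems]] by (simp only: even_cf.simps weber_even_shift)
  then show ?case
    by (simp add: Cons add_divide_distrib e2pi_add)
qed simp

lemma even_cf_eq:
  assumes "Im z > 0" "even_cf_matrix as = (p, q, r, s)"
  shows "even_cf as z * (of_int r * z + of_int s) = of_int p * z + of_int q \<and> of_int r * z + of_int s \<noteq> 0"
  using assms(2)
proof (induction as arbitrary: p q r s)
  case (Cons a as)
  obtain p' q' r' s' where m: "even_cf_matrix as = (p', q', r', s')"
    by (metis prod_cases4)
  from Cons.IH[OF m] have IH: "even_cf as z * (of_int r' * z + of_int s') = of_int p' * z + of_int q'"
    "of_int r' * z + of_int s' \<noteq> 0"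
    by auto
  have e: "even_cf as z \<noteq> 0"
    using Im_even_cf_pos[OF assms(1), of as] by auto
  have [simp]: "p = 2 * a * p' - r'" "q = 2 * a * q' - s'" "r = p'" "s = q'"
    using Cons.prems m by auto
  have nz: "of_int r * z + of_int s \<noteq> 0"
    using IH e by (metis \<open>r = p'\<close> \<open>s = q'\<close> mult_eq_0_iff)
  have "(- 1 / even_cf as z) * (of_int p' * z + of_int q') = - (of_int r' * z + of_int s')"
    unfolding IH(1)[symmetric] using e by simp
  then have "even_cf (a # as) z * (of_int r * z + of_int s) =
      2 * of_int a * (of_int p' * z + of_int q') + - (of_int r' * z + of_int s')"
    by (simp only: even_cf.simps distrib_right[of "2 * of_int a"] \<open>r = p'\<close> \<open>s = q'\<close>)
  also have "\<dots> = of_int p * z + of_int q"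
    by (simp add: algebra_simps)
  finally show ?case
    using nz by blast
qed auto


lemma e2pi_mod_24: "n mod 24 = m \<Longrightarrow> e2pi (of_int n / 24) = e2pi (of_int m / 24)"
proof -
  assume m: "n mod 24 = m"
  have "n = m + 24 * (n div 24)"
    using m by presburger
  then have "(of_int n :: complex) = of_int m + 24 * of_int (n div 24)"
    by (metis of_int_add of_int_mult of_int_numeral)
  then have "(of_int n / 24 :: complex) = of_int m / 24 + of_int (n div 24)"
    by simp
  then show ?thesis
    by (rule e2pi_eqI)
qed

text \<open>The matrix (2k, q; 13, -2l) has determinant 1 by the condition on \<open>q\<close>;
  \<open>e\<close> allows for the sign with which a word realises it. The word yields the exponent
  \<open>u\<close> of the first Weber value, while the second, at 13 times the argument, needs only
  two even shifts and one inversion, whence \<open>v\<close>. The congruences say that the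
  multipliers fit a scaling rule of the equation.\<close>

lemma schlaefli_norm_word:
  assumes \<tau>: "Im \<tau> > 0"
    and word: "even_cf_matrix as = (e * (2 * k), e * q, e * 13, - e * (2 * l))" "e \<noteq> 0"
    and q: "13 * q = - (4 * k * l + 1)"
    and i: "even_cf_index as i = inversion_index i"
    and u: "u = even_cf_exponent as i"
    and v: "v = even_shift_exponent i * k - even_shift_exponent (inversion_index i) * l"
    and d: "(v - u) mod 24 = d" "d = 0 \<or> d = 12"
    and s: "6 * (u + v) mod 24 = (if i = 0 then d else 12 - d)"
  shows "schlaefli_norm i ((- 1 / \<tau> + 2 * of_int k) / 13) =
    schlaefli_norm (inversion_index i) ((\<tau> + 2 * of_int l) / 13)"
proof -
  define \<sigma> where "\<sigma> = (\<tau> + 2 * of_int l) / 13"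
  have \<sigma>: "Im \<sigma> > 0" "\<tau> = 13 * \<sigma> - 2 * of_int l"
    using \<tau> by (simp_all add: \<sigma>_def field_simps)
  have \<tau>0: "\<tau> \<noteq> 0"
    using \<tau> by auto
  have "even_cf as \<sigma> * (of_int e * \<tau>) = of_int e * (2 * of_int k * \<sigma> + of_int q)"
    using even_cf_eq[OF \<sigma>(1) word(1)] by (simp add: \<sigma>(2) algebra_simps)
  then have "even_cf as \<sigma> * \<tau> = 2 * of_int k * \<sigma> + of_int q"
    using word(2) by (simp add: mult.left_commute)
  moreover have "13 * (of_int q :: complex) = - (4 * of_int k * of_int l + 1)"
    using arg_cong[OF q, of "of_int :: int \<Rightarrow> complex"] by simp
  ultimately have "13 * (even_cf as \<sigma> * \<tau>) = 2 * of_int k * \<tau> - 1"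
    by (simp add: \<sigma>(2) algebra_simps)
  then have eq: "(- 1 / \<tau> + 2 * of_int k) / 13 = even_cf as \<sigma>"
    using \<tau>0 by (simp add: field_simps)
  have x: "weber i (even_cf as \<sigma>) = e2pi (of_int u / 24) * weber (inversion_index i) \<sigma>"
    using weber_even_cf[OF \<sigma>(1)] i u by simp
  have "13 * even_cf as \<sigma> = 2 * of_int k + - 1 / \<tau>"
    unfolding eq[symmetric] by simp
  moreover have "weber (inversion_index i) \<tau> =
      e2pi (of_int (even_shift_exponent (inversion_index i) * (- l)) / 24) * weber (inversion_index i) (13 * \<sigma>)"
    unfolding \<sigma>(2) using weber_even_shift[of "inversion_index i" "- l" "13 * \<sigma>"] by simp
  ultimately have y: "weber i (13 * even_cf as \<sigma>) = e2pi (of_int v / 24) * weber (inversion_index i) (13 * \<sigma>)"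
    using v by (simp only: weber_even_shift weber_inversion[OF \<tau>] mult.assoc[symmetric] e2pi_add[symmetric])
      (simp add: diff_divide_distrib)
  \<comment> \<open>For i = 0 the ratio of multipliers is \<open>?c\<close> and plain scaling
    applies; for i > 0 it is - \<open>?c\<close>, which accounts for the change of index.\<close>
  let ?c = "if i = 0 then e2pi (of_int d / 24) else - e2pi (of_int d / 24)"
  have c: "?c = 1 \<or> ?c = - 1"
    using d(2) by auto
  have "e2pi (of_int v / 24) / e2pi (of_int u / 24) = e2pi (of_int d / 24)"
    using e2pi_mod_24[OF d(1)] by (simp add: diff_divide_distrib e2pi_diff)
  moreover have "(e2pi (of_int u / 24) * e2pi (of_int v / 24)) ^ 6 = ?c"
  proof -
    have "(e2pi (of_int u / 24) * e2pi (of_int v / 24)) ^ 6 = e2pi (of_int (6 * (u + v)) / 24)"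
      by (simp add: e2pi_power add_divide_distrib flip: e2pi_add)
    also have "\<dots> = ?c"
      using e2pi_mod_24[OF s] d(2) by auto
    finally show ?thesis .
  qed
  ultimately have "schlaefli i (weber i (even_cf as \<sigma>)) (weber i (13 * even_cf as \<sigma>)) =
     ?c * schlaefli (inversion_index i) (weber (inversion_index i) \<sigma>) (weber (inversion_index i) (13 * \<sigma>))"
    unfolding x y
    using schlaefli_scale[of "e2pi (of_int v / 24)" "e2pi (of_int u / 24)" "?c" i]
      schlaefli_scale_minus[of "e2pi (of_int v / 24)" "e2pi (of_int u / 24)" "?c" i] c
    by (cases "i = 0") (simp_all add: inversion_index_def)
  moreover have "norm ?c = 1"
    using c by (elim disjE) (simp_all only: norm_one norm_minus_cancel)
  ultimately show ?thesis
    unfolding schlaefli_norm_def eq \<sigma>_def by (simp only: norm_mult mult_1)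
qed

text \<open>As q is odd, the matrix (2k, q; 13, -2l) is congruent to (0, 1; 1, 0) modulo 2. It
  therefore lies in the theta group and has an even continued fraction, of odd length because the
  index must be inverted.\<close>

lemma schlaefli_norm_inversion_line:
  assumes \<tau>: "Im \<tau> > 0" and i: "i \<in> {0, 1, 2}" and k: "\<not> 13 dvd k"
  shows "\<exists>l. schlaefli_norm i ((- 1 / \<tau> + 2 * of_int k) / 13) =
    schlaefli_norm (inversion_index i) ((\<tau> + 2 * of_int l) / 13)"
proof -
  define P where "P = (\<lambda>k l. schlaefli_norm i ((- 1 / \<tau> + 2 * of_int k) / 13) =
    schlaefli_norm (inversion_index i) ((\<tau> + 2 * of_int l) / 13))"
  \<comment> \<open>The lists are even continued fractions of the matrices \<open>(2 k, q; 13, - 2 l)\<close>, which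
    for \<open>4 k l = - 1\<close> modulo \<open>13\<close> carry \<open>(\<tau> + 2 l) / 13\<close> to \<open>(- 1 / \<tau> + 2 k) / 13\<close>.\<close>
  note word = schlaefli_norm_word[OF \<tau> _ _ _ _ refl refl refl]
  have eval: "inversion_index 0 = 0" "inversion_index (Suc 0) = 2" "inversion_index 2 = Suc 0"
    "even_shift_exponent 0 = - 1" "even_shift_exponent (Suc 0) = - 1" "even_shift_exponent 2 = 2"
    by (simp_all add: inversion_index_def even_shift_exponent_def)
  have i: "i = 0 \<or> i = Suc 0 \<or> i = 2"
    using i by auto
  \<comment> \<open>One word for each nonzero residue modulo 13. Negating a list replaces (k, l) by
    (-k, -l), so the last six cases mirror the first six.\<close>
  have w0: "P (- 6) 6"
    unfolding P_def
    by (rule word[where as = "[0, 1, 1, 1, 1, 1, 1, 1, 1, 1, 1, 1, 1]" and e = "1" and q = "11"])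
      (use i in \<open>elim disjE; simp add: eval\<close>)+
  have w1: "P (- 5) 2"
    unfolding P_def
    by (rule word[where as = "[0, 1, 1, 1, 2]" and e = "1" and q = "3"])
      (use i in \<open>elim disjE; simp add: eval\<close>)+
  have w2: "P (- 4) (- 4)"
    unfolding P_def
    by (rule word[where as = "[0, 1, 1, - 1, - 1]" and e = "1" and q = "- 5"])
      (use i in \<open>elim disjE; simp add: eval\<close>)+
  have w3: "P (- 3) (- 1)"
    unfolding P_def
    by (rule word[where as = "[0, 1, - 3]" and e = "- 1" and q = "- 1"])
      (use i in \<open>elim disjE; simp add: eval\<close>)+
  have w4: "P (- 2) 5"
    unfolding P_def
    by (rule word[where as = "[0, 2, 1, 1, 1]" and e = "1" and q = "3"])
      (use i in \<open>elim disjE; simp add: eval\<close>)+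
  have w5: "P (- 1) (- 3)"
    unfolding P_def
    by (rule word[where as = "[0, 3, - 1]" and e = "- 1" and q = "- 1"])
      (use i in \<open>elim disjE; simp add: eval\<close>)+
  have w6: "P 1 3"
    unfolding P_def
    by (rule word[where as = "[0, - 3, 1]" and e = "- 1" and q = "- 1"])
      (use i in \<open>elim disjE; simp add: eval\<close>)+
  have w7: "P 2 (- 5)"
    unfolding P_def
    by (rule word[where as = "[0, - 2, - 1, - 1, - 1]" and e = "1" and q = "3"])
      (use i in \<open>elim disjE; simp add: eval\<close>)+
  have w8: "P 3 1"
    unfolding P_def
    by (rule word[where as = "[0, - 1, 3]" and e = "- 1" and q = "- 1"])
      (use i in \<open>elim disjE; simp add: eval\<close>)+
  have w9: "P 4 4"
    unfolding P_def
    by (rule word[where as = "[0, - 1, - 1, 1, 1]" and e = "1" and q = "- 5"])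
      (use i in \<open>elim disjE; simp add: eval\<close>)+
  have w10: "P 5 (- 2)"
    unfolding P_def
    by (rule word[where as = "[0, - 1, - 1, - 1, - 2]" and e = "1" and q = "3"])
      (use i in \<open>elim disjE; simp add: eval\<close>)+
  have w11: "P 6 (- 6)"
    unfolding P_def
    by (rule word[where as = "[0, - 1, - 1, - 1, - 1, - 1, - 1, - 1, - 1, - 1, - 1, - 1, - 1]" and e = "1" and q = "11"])
      (use i in \<open>elim disjE; simp add: eval\<close>)+
  \<comment> \<open>Adding 6 before dividing centres the residue \<open>k0\<close> in -6..6.\<close>
  define m where "m = (k + 6) div 13"
  define k0 where "k0 = k - 13 * m"
  have "k0 \<in> {-6..6}" "k0 \<noteq> 0"
    using k unfolding k0_def m_def by (auto simp: dvd_def)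
  then have "k0 \<in> {- 6, - 5, - 4, - 3, - 2, - 1, 1, 2, 3, 4, 5, 6}"
    by simp presburger
  then obtain l where "P k0 l"
    using w0 w1 w2 w3 w4 w5 w6 w7 w8 w9 w10 w11 by blast
  moreover have "(- 1 / \<tau> + 2 * of_int k) / 13 = (- 1 / \<tau> + 2 * of_int k0) / 13 + 2 * of_int m"
    by (simp add: k0_def field_simps)
  ultimately show ?thesis
    unfolding P_def by (metis schlaefli_norm_plus_even)
qed

section \<open>Conjugate values and reduction to a strip\<close>

text \<open>By f1(2\<tau>) f2(\<tau>) = sqrt 2, passing to index 2 is x -> sqrt 2 / x: the two
  sixth-power terms are exchanged and y/x is inverted.\<close>

lemma schlaefli_norm_2_eq:
  assumes "Im \<tau> > 0"
  shows "schlaefli_norm 2 \<tau> = schlaefli_norm 1 (2 * \<tau>)"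
proof -
  have eq: "weber2 z = of_real (sqrt 2) / weber1 (2 * z)" if "Im z > 0" for z
    using weber1_double_mult_weber2[OF that] weber1_nonzero[of "2 * z"] that
    by (simp add: eq_divide_eq mult.commute)
  have "schlaefli 2 (of_real (sqrt 2) / x) (of_real (sqrt 2) / y) = schlaefli 1 x y" for x y
  proof -
    have "(of_real (sqrt 2) / x) * (of_real (sqrt 2) / y) = 2 / (x * y)"
      by (simp flip: of_real_mult)
    moreover have "(of_real (sqrt 2) / y) / (of_real (sqrt 2) / x) = 1 / (y / x)"
      by simp
    moreover have "(2 / (x * y)) ^ 6 = 64 / (x * y) ^ 6" "64 / (64 / (x * y) ^ 6) = (x * y) ^ 6"
      by (simp_all add: power_divide)
    ultimately show ?thesis
      unfolding schlaefli_def by (simp only: odd_part_inverse) simp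
  qed
  moreover have "13 * (2 * \<tau>) = 2 * (13 * \<tau>)"
    by simp
  ultimately show ?thesis
    using eq[of \<tau>] eq[of "13 * \<tau>"] assms
    by (simp only: schlaefli_norm_def weber_def) simp
qed

text \<open>Up to unimodular factors, these are the values at \<open>\<tau>\<close> of the images of the function
  \<open>schlaefli_norm 1\<close> under \<open>SL\<^sub>2(\<int>)\<close>.\<close>
definition conjugate_value :: "complex \<Rightarrow> real \<Rightarrow> bool" where
  "conjugate_value \<tau> x \<longleftrightarrow> (\<exists>i\<in>{0, 1, 2}. x = schlaefli_norm i \<tau> \<or>
     (\<exists>k::int. x = schlaefli_norm i ((\<tau> + 2 * of_int k) / 13)))"

lemma conjugate_value_plus_1_imp: "conjugate_value (\<tau> + 1) x \<Longrightarrow> conjugate_value \<tau> x"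
proof -
  have idx: "shift_index i \<in> {0, 1, 2}" if "i \<in> {0, 1, 2}" for i
    using that by (auto simp: shift_index_def)
  assume "conjugate_value (\<tau> + 1) x"
  then obtain i where i: "i \<in> {0, 1, 2}" "x = schlaefli_norm i (\<tau> + 1) \<or>
     (\<exists>k::int. x = schlaefli_norm i ((\<tau> + 1 + 2 * of_int k) / 13))"
    unfolding conjugate_value_def by blast
  \<comment> \<open>Only even shifts are available inside the fraction, so 1 is written as 13 - 2 *
    6.\<close>
  have "(\<tau> + 1 + 2 * of_int k) / 13 = (\<tau> + 2 * of_int (k - 6)) / 13 + 1" for k
    by (simp add: field_simps)
  with i have "x = schlaefli_norm (shift_index i) \<tau> \<or>
     (\<exists>k::int. x = schlaefli_norm (shift_index i) ((\<tau> + 2 * of_int (k - 6)) / 13))"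
    by (simp only: schlaefli_norm_plus_1)
  with idx[OF i(1)] show ?thesis
    unfolding conjugate_value_def by blast
qed

lemma conjugate_value_imp_plus_1: "conjugate_value \<tau> x \<Longrightarrow> conjugate_value (\<tau> + 1) x"
proof -
  have idx: "shift_index i \<in> {0, 1, 2}" if "i \<in> {0, 1, 2}" for i
    using that by (auto simp: shift_index_def)
  have bk: "schlaefli_norm i z = schlaefli_norm (shift_index i) (z + 1)" for i z
    by (simp add: schlaefli_norm_plus_1)
  assume "conjugate_value \<tau> x"
  then obtain i where i: "i \<in> {0, 1, 2}" "x = schlaefli_norm i \<tau> \<or>
     (\<exists>k::int. x = schlaefli_norm i ((\<tau> + 2 * of_int k) / 13))"
    unfolding conjugate_value_def by blast
  have "(\<tau> + 2 * of_int k) / 13 + 1 = (\<tau> + 1 + 2 * of_int (k + 6)) / 13" for k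
    by (simp add: field_simps)
  with i(2) have "x = schlaefli_norm (shift_index i) (\<tau> + 1) \<or>
     (\<exists>k::int. x = schlaefli_norm (shift_index i) ((\<tau> + 1 + 2 * of_int (k + 6)) / 13))"
    by (simp only: bk[of i])
  with idx[OF i(1)] show ?thesis
    unfolding conjugate_value_def by blast
qed

lemma conjugate_value_plus_int: "conjugate_value (\<tau> + of_int m) x = conjugate_value \<tau> x"
proof -
  have "conjugate_value (z + 1) x = conjugate_value z x" for z
    using conjugate_value_plus_1_imp conjugate_value_imp_plus_1 by blast
  from periodic_of_int[of "\<lambda>\<tau>. conjugate_value \<tau> x", OF this] show ?thesis
    by simp
qed

text \<open>The action on the projective line over the field with 13 elements: infinity (the
  argument \<tau>) and k = 0 are exchanged by the Fricke involution, the other twelve points are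
  permuted among themselves.\<close>

lemma conjugate_value_inversion:
  assumes \<tau>: "Im \<tau> > 0" and x: "conjugate_value (- 1 / \<tau>) x"
  shows "conjugate_value \<tau> x"
proof -
  have idx: "inversion_index i \<in> {0, 1, 2}" for i
    by (auto simp: inversion_index_def)
  have introI: "conjugate_value \<tau> x" if "x = schlaefli_norm (inversion_index i) \<tau> \<or>
     (\<exists>k::int. x = schlaefli_norm (inversion_index i) ((\<tau> + 2 * of_int k) / 13))" for i
    using that idx[of i] unfolding conjugate_value_def by blast
  obtain i where i: "i \<in> {0, 1, 2}" "x = schlaefli_norm i (- 1 / \<tau>) \<or>
     (\<exists>k::int. x = schlaefli_norm i ((- 1 / \<tau> + 2 * of_int k) / 13))"
    using x unfolding conjugate_value_def by blast
  from i(2) show ?thesis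
  proof
    assume "x = schlaefli_norm i (- 1 / \<tau>)"
    then have "x = schlaefli_norm (inversion_index i) ((\<tau> + 2 * of_int 0) / 13)"
      using schlaefli_norm_inversion[of "\<tau> / 13" i] \<tau> by simp
    then show ?thesis
      using introI by blast
  next
    assume "\<exists>k::int. x = schlaefli_norm i ((- 1 / \<tau> + 2 * of_int k) / 13)"
    then obtain k :: int where k: "x = schlaefli_norm i ((- 1 / \<tau> + 2 * of_int k) / 13)" ..
    show ?thesis
    proof (cases "13 dvd k")
      case True
      then obtain m where "k = 13 * m" ..
      then have "(- 1 / \<tau> + 2 * of_int k) / 13 = - 1 / (13 * \<tau>) + 2 * of_int m"
        by (simp add: field_simps)
      then have "x = schlaefli_norm (inversion_index i) \<tau>"
        unfolding k by (simp only: schlaefli_norm_plus_even schlaefli_norm_inversion[OF \<tau>])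
      then show ?thesis
        using introI by blast
    next
      case False
      from schlaefli_norm_inversion_line[OF \<tau> i(1) this] show ?thesis
        unfolding k[symmetric] using introI by blast
    qed
  qed
qed

lemma shift_to_strip:
  obtains m :: int where "\<bar>Re (\<tau> + of_int m)\<bar> \<le> 1 / 2"
proof (rule that[of "- \<lfloor>Re \<tau> + 1 / 2\<rfloor>"])
  have "Re (\<tau> + of_int (- \<lfloor>Re \<tau> + 1 / 2\<rfloor>)) = Re \<tau> - of_int \<lfloor>Re \<tau> + 1 / 2\<rfloor>"
    by simp
  then show "\<bar>Re (\<tau> + of_int (- \<lfloor>Re \<tau> + 1 / 2\<rfloor>))\<bar> \<le> 1 / 2"
    by linarith
qed

text \<open>If |Re| <= 1/2 and Im < 1/2, then the squared modulus is at most 1/2 and inversion at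
  least doubles the height. The bound 1/2, lower than that of the fundamental domain, makes the
  number of doublings an induction measure.\<close>

lemma conjugate_value_reduction:
  assumes "Im \<tau> > 0" "conjugate_value \<tau> x"
  obtains \<tau>' where "Im \<tau>' \<ge> 1 / 2" "conjugate_value \<tau>' x"
proof -
  have *: "\<exists>\<tau>'. Im \<tau>' \<ge> 1 / 2 \<and> conjugate_value \<tau>' x"
    if "Im \<tau> > 0" "conjugate_value \<tau> x" "2 ^ n * Im \<tau> \<ge> 1 / 2" for n \<tau>
    using that
  proof (induction n arbitrary: \<tau>)
    case (Suc n)
    show ?case
    proof (cases "Im \<tau> \<ge> 1 / 2")
      case False
      obtain m :: int where m: "\<bar>Re (\<tau> + of_int m)\<bar> \<le> 1 / 2"
        by (rule shift_to_strip)
      define \<sigma> where "\<sigma> = \<tau> + of_int m"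
      have \<sigma>: "Im \<sigma> = Im \<tau>" "conjugate_value \<sigma> x"
        using Suc.prems by (simp_all add: \<sigma>_def conjugate_value_plus_int)
      have pos: "Im (- 1 / \<sigma>) > 0"
        using Im_minus_inverse_pos[of \<sigma>] Suc.prems \<sigma> by simp
      have "conjugate_value (- 1 / \<sigma>) x"
        by (rule conjugate_value_inversion[OF pos]) (use \<sigma> in simp)
      moreover have "Im (- 1 / \<sigma>) \<ge> 2 * Im \<tau>"
      proof -
        have "(Re \<sigma>)\<^sup>2 \<le> (1 / 2)\<^sup>2"
          using m abs_le_square_iff[of "Re \<sigma>" "1 / 2"] by (simp add: \<sigma>_def)
        moreover have "(Im \<sigma>)\<^sup>2 \<le> (1 / 2)\<^sup>2"
          using False Suc.prems \<sigma> by (intro power_mono) auto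
        ultimately have "(Re \<sigma>)\<^sup>2 + (Im \<sigma>)\<^sup>2 \<le> 1 / 2"
          by (simp add: power2_eq_square)
        moreover have "(Re \<sigma>)\<^sup>2 + (Im \<sigma>)\<^sup>2 > 0"
          using Suc.prems \<sigma> by (simp add: sum_power2_gt_zero_iff)
        moreover have "Im (- 1 / \<sigma>) = Im \<tau> / ((Re \<sigma>)\<^sup>2 + (Im \<sigma>)\<^sup>2)"
          using \<sigma> by (simp add: Im_divide)
        ultimately show ?thesis
          using Suc.prems(1) by (simp add: pos_le_divide_eq)
      qed
      then have "2 ^ n * Im (- 1 / \<sigma>) \<ge> 2 ^ n * (2 * Im \<tau>)"
        by (intro mult_left_mono) auto
      then have "2 ^ n * Im (- 1 / \<sigma>) \<ge> 1 / 2"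
        using Suc.prems(3) by simp
      ultimately show ?thesis
        using Suc.IH pos by blast
    qed (use Suc.prems in blast)
  qed auto
  obtain n where "1 / 2 / Im \<tau> < 2 ^ n"
    using real_arch_pow[of 2 "1 / 2 / Im \<tau>"] by auto
  then have "2 ^ n * Im \<tau> \<ge> 1 / 2"
    using assms(1) by (simp add: field_simps)
  from *[OF assms this] show thesis
    using that by blast
qed

text \<open>Height 1/2 divided by 13 gives 1/26; indices 0 and 2 are brought to 1 by v + 1 and 2 v,
  which do not lower the height.\<close>

lemma schlaefli_norm_reduction:
  assumes "Im \<tau> > 0"
  obtains w where "Im w \<ge> 1 / 26" "\<bar>Re w\<bar> \<le> 1" "schlaefli_norm 1 \<tau> = schlaefli_norm 1 w"
proof -
  have "conjugate_value \<tau> (schlaefli_norm 1 \<tau>)"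
    unfolding conjugate_value_def by blast
  then obtain \<tau>' where \<tau>': "Im \<tau>' \<ge> 1 / 2" "conjugate_value \<tau>' (schlaefli_norm 1 \<tau>)"
    by (rule conjugate_value_reduction[OF assms])
  then obtain i v where v: "i \<in> {0, 1, 2}" "Im v \<ge> 1 / 26" "schlaefli_norm 1 \<tau> = schlaefli_norm i v"
  proof -
    from \<tau>'(2) obtain i where i: "i \<in> {0, 1, 2}" and "schlaefli_norm 1 \<tau> = schlaefli_norm i \<tau>' \<or>
       (\<exists>k::int. schlaefli_norm 1 \<tau> = schlaefli_norm i ((\<tau>' + 2 * of_int k) / 13))"
      unfolding conjugate_value_def by blast
    then show thesis
      using \<tau>'(1) that[OF i, of \<tau>'] that[OF i, of "(\<tau>' + 2 * of_int k) / 13" for k] by auto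
  qed
  obtain u where u: "Im u \<ge> 1 / 26" "schlaefli_norm 1 \<tau> = schlaefli_norm 1 u"
  proof -
    consider "i = 0" | "i = 1" | "i = 2"
      using v(1) by auto
    then show thesis
    proof cases
      case 1
      then show thesis
        using v that[of "v + 1"] by (simp add: schlaefli_norm_plus_1 shift_index_def)
    next
      case 2
      then show thesis
        using v that by blast
    next
      case 3
      then show thesis
        using v that[of "2 * v"] by (simp add: schlaefli_norm_2_eq)
    qed
  qed
  \<comment> \<open>The norm has period 2, hence the strip of width 2, found by rounding
    u/2.\<close>
  obtain m :: int where m: "\<bar>Re (u / 2 + of_int m)\<bar> \<le> 1 / 2"
    by (rule shift_to_strip)
  have "Re (u + 2 * of_int m) = 2 * Re (u / 2 + of_int m)"
    by simp
  then have "\<bar>Re (u + 2 * of_int m)\<bar> \<le> 1"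
    using m by linarith
  then show thesis
    using u that[of "u + 2 * of_int m"] by (simp add: schlaefli_norm_plus_even)
qed

subsection \<open>Vanishing at the cusp\<close>

text \<open>The logarithmic majorant sums to at most 2|a| <= 1, and exp y <= 1 + y + y^2 <= 1 + 2y
  on [0, 1].\<close>

lemma norm_qpoch_inf_minus_1_le:
  assumes q: "norm q \<le> 1 / 2" and a: "norm a \<le> 1 / 2"
  shows "norm (qpoch_inf a q - 1) \<le> 4 * norm a"
proof -
  have "norm ((\<Prod>n<N. 1 - a * q ^ n) - 1) \<le> 4 * norm a" for N
  proof -
    have "norm ((\<Prod>n<N. 1 + - (a * q ^ n)) - 1) \<le> (\<Prod>n<N. 1 + norm (- (a * q ^ n))) - 1"
      by (rule norm_prod_minus1_le_prod_minus1)
    also have "(\<Prod>n<N. 1 + norm (- (a * q ^ n))) \<le> exp (\<Sum>n<N. norm (- (a * q ^ n)))"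
      by (rule prod_le_exp_sum) auto
    also have "(\<Sum>n<N. norm (- (a * q ^ n))) \<le> 2 * norm a"
    proof -
      have "(\<Sum>n<N. norm (- (a * q ^ n))) \<le> (\<Sum>n<N. norm a * (1 / 2) ^ n)"
        unfolding norm_minus_cancel norm_mult norm_power
        by (intro sum_mono mult_left_mono power_mono q) auto
      also have "\<dots> = norm a * (\<Sum>n<N. (1 / 2) ^ n)"
        by (simp add: sum_distrib_left)
      also have "(\<Sum>n<N. (1 / 2) ^ n) \<le> (2 :: real)"
        by (simp add: sum_gp_strict)
      finally show ?thesis
        by (simp add: mult_left_mono)
    qed
    also have "exp (2 * norm a) \<le> 1 + 2 * norm a + (2 * norm a)\<^sup>2"
      using a by (intro exp_bound) auto
    also have "(2 * norm a)\<^sup>2 \<le> 2 * norm a * 1"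
      unfolding power2_eq_square using a by (intro mult_left_mono) auto
    finally show ?thesis
      by simp
  qed
  moreover have "(\<lambda>N. norm ((\<Prod>n<N. 1 - a * q ^ n) - 1)) \<longlonglongrightarrow> norm (qpoch_inf a q - 1)"
    using q by (intro tendsto_intros qpoch_inf_LIMSEQ) auto
  ultimately show ?thesis
    by (intro LIMSEQ_le_const2) auto
qed

section \<open>Expansions modulo t^4\<close>

text \<open>Congruence modulo t^4 of germs at 0. Boundedness is built in so that the relation is
  compatible with products.\<close>

definition cong4 :: "(complex \<Rightarrow> complex) \<Rightarrow> (complex \<Rightarrow> complex) \<Rightarrow> bool" where
  "cong4 f g \<longleftrightarrow> f \<in> O[at 0](\<lambda>_. 1) \<and> g \<in> O[at 0](\<lambda>_. 1) \<and> (\<lambda>t. f t - g t) \<in> O[at 0](\<lambda>t. t ^ 4)"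

lemma bigo_1_mult:
  fixes f g :: "complex \<Rightarrow> complex"
  assumes "f \<in> O[at 0](\<lambda>_. 1)" "g \<in> O[at 0](\<lambda>_. 1)"
  shows "(\<lambda>t. f t * g t) \<in> O[at 0](\<lambda>_. 1)"
  using landau_o.big.mult[OF assms] by simp

lemma cong4_mult:
  assumes "cong4 f f'" "cong4 g g'"
  shows "cong4 (\<lambda>t. f t * g t) (\<lambda>t. f' t * g' t)"
proof -
  have "(\<lambda>t. (f t - f' t) * g t + f' t * (g t - g' t)) \<in> O[at 0](\<lambda>t. t ^ 4)"
  proof (rule sum_in_bigo)
    show "(\<lambda>t. (f t - f' t) * g t) \<in> O[at 0](\<lambda>t. t ^ 4)"
      using landau_o.big.mult[of "\<lambda>t. f t - f' t" "at 0" "\<lambda>t. t ^ 4" g "\<lambda>_. 1"] assms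
      by (simp add: cong4_def)
    show "(\<lambda>t. f' t * (g t - g' t)) \<in> O[at 0](\<lambda>t. t ^ 4)"
      using landau_o.big.mult[of f' "at 0" "\<lambda>_. 1" "\<lambda>t. g t - g' t" "\<lambda>t. t ^ 4"] assms
      by (simp add: cong4_def)
  qed
  then have "(\<lambda>t. f t * g t - f' t * g' t) \<in> O[at 0](\<lambda>t. t ^ 4)"
    by (simp add: algebra_simps)
  moreover have "(\<lambda>t. f t * g t) \<in> O[at 0](\<lambda>_. 1)" "(\<lambda>t. f' t * g' t) \<in> O[at 0](\<lambda>_. 1)"
    using assms bigo_1_mult by (simp_all add: cong4_def)
  ultimately show ?thesis
    by (simp add: cong4_def)
qed

lemma cong4_add:
  assumes "cong4 f f'" "cong4 g g'"
  shows "cong4 (\<lambda>t. f t + g t) (\<lambda>t. f' t + g' t)"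
proof -
  have "(\<lambda>t. (f t - f' t) + (g t - g' t)) \<in> O[at 0](\<lambda>t. t ^ 4)"
    using assms unfolding cong4_def by (intro sum_in_bigo(1)) blast+
  then have "(\<lambda>t. (f t + g t) - (f' t + g' t)) \<in> O[at 0](\<lambda>t. t ^ 4)"
    by (simp add: algebra_simps)
  then show ?thesis
    using assms by (auto simp: cong4_def intro: sum_in_bigo)
qed

lemma cong4_trans: "cong4 f g \<Longrightarrow> cong4 g h \<Longrightarrow> cong4 f h"
  using sum_in_bigo(1)[of "\<lambda>t. f t - g t" "at 0" "\<lambda>t. t ^ 4" "\<lambda>t. g t - h t"] by (simp add: cong4_def)

lemma bigo_1_isCont:
  fixes f :: "complex \<Rightarrow> complex"
  shows "isCont f 0 \<Longrightarrow> f \<in> O[at 0](\<lambda>_. 1)"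
  by (rule bigoI_tendsto[of _ _ "f 0"]) (simp_all add: isCont_def)

lemma cong4_refl: "isCont f 0 \<Longrightarrow> cong4 f f"
  by (simp add: cong4_def bigo_1_isCont)

lemma cong4I:
  assumes "isCont f 0" "isCont g 0" "isCont h 0" "\<And>t. f t = g t + t ^ 4 * h t"
  shows "cong4 f g"
proof -
  have "(\<lambda>t. t ^ 4 * h t) \<in> O[at 0](\<lambda>t. t ^ 4 * 1)"
    by (intro landau_o.big.mult bigo_1_isCont assms) auto
  then show ?thesis
    using assms by (simp add: cong4_def bigo_1_isCont)
qed

text \<open>The modular equation multiplied out, with \<open>t = q\<^sup>1\<^sup>/\<^sup>2\<close> and \<open>p\<close>, \<open>r\<close> standing for
  the infinite products in \<open>weber1 \<tau>\<close> and \<open>weber1 (13 * \<tau>)\<close>.\<close>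
definition cusp_poly :: "complex \<Rightarrow> complex \<Rightarrow> complex \<Rightarrow> complex" where
  "cusp_poly t p r = p ^ 13 * r ^ 13 + 64 * t ^ 7 * p * r - (r ^ 14 - t ^ 7 * p ^ 14
     - 13 * (t * r ^ 12 * p ^ 2 - t ^ 6 * p ^ 12 * r ^ 2)
     + 52 * (t ^ 2 * r ^ 10 * p ^ 4 - t ^ 5 * p ^ 10 * r ^ 4)
     - 78 * (t ^ 3 * r ^ 8 * p ^ 6 - t ^ 4 * p ^ 8 * r ^ 6))"

lemma cong4_power: "cong4 f g \<Longrightarrow> cong4 (\<lambda>t. f t ^ n) (\<lambda>t. g t ^ n)"
proof (induction n)
  case 0
  show ?case
    by (simp add: cong4_refl)
next
  case (Suc n)
  then show ?case
    using cong4_mult[of f g] by simp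
qed

text \<open>One link of an addition chain: two truncated powers are multiplied, and \<open>h\<close>
  is the explicit overflow divided by t^4.\<close>

lemma cong4_power_add:
  assumes "cong4 (\<lambda>t. f t ^ m) g" "cong4 (\<lambda>t. f t ^ n) g'" "\<And>t. g t * g' t = k t + t ^ 4 * h t"
    "isCont k 0" "isCont h 0" "l = m + n"
  shows "cong4 (\<lambda>t. f t ^ l) k"
proof -
  have "(\<lambda>t. (g t * g' t) - k t) \<in> O[at 0](\<lambda>t. t ^ 4)"
    using landau_o.big.mult[OF landau_o.big_refl bigo_1_isCont[OF assms(5)], of "\<lambda>t. t ^ 4"] assms(3) by simp
  then have "cong4 (\<lambda>t. g t * g' t) k"
    using cong4_mult[OF assms(1,2)] assms(4) by (simp add: cong4_def bigo_1_isCont)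
  with cong4_mult[OF assms(1,2)] show ?thesis
    unfolding assms(6) power_add by (rule cong4_trans)
qed

lemma cong4_cusp_poly:
  assumes p: "cong4 p (\<lambda>t. 1 - t - t ^ 3)" and r: "cong4 r (\<lambda>_. 1)"
  shows "(\<lambda>t. cusp_poly t (p t) (r t)) \<in> O[at 0](\<lambda>t. t ^ 4)"
proof -
  have rn: "cong4 (\<lambda>t. r t ^ n) (\<lambda>_. 1)" for n
    using cong4_power[OF r, of n] by simp
  have p1: "cong4 (\<lambda>t. p t ^ 1) (\<lambda>t. 1 - t - t ^ 3)"
    using p by simp
  have p2: "cong4 (\<lambda>t. p t ^ 2) (\<lambda>t. 1 - 2 * t + t ^ 2 - 2 * t ^ 3)"
    by (rule cong4_power_add[OF p1 p1, where h = "\<lambda>t. 2 + t ^ 2"])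
      (auto simp: algebra_simps power_numeral_reduce)
  have p4: "cong4 (\<lambda>t. p t ^ 4) (\<lambda>t. 1 - 4 * t + 6 * t ^ 2 - 8 * t ^ 3)"
    by (rule cong4_power_add[OF p2 p2, where h = "\<lambda>t. 9 - 4 * t + 4 * t ^ 2"])
      (auto simp: algebra_simps power_numeral_reduce)
  have p6: "cong4 (\<lambda>t. p t ^ 6) (\<lambda>t. 1 - 6 * t + 15 * t ^ 2 - 26 * t ^ 3)"
    by (rule cong4_power_add[OF p4 p2, where h = "\<lambda>t. 30 - 20 * t + 16 * t ^ 2"])
      (auto simp: algebra_simps power_numeral_reduce)
  have p8: "cong4 (\<lambda>t. p t ^ 8) (\<lambda>t. 1 - 8 * t + 28 * t ^ 2 - 64 * t ^ 3)"
    by (rule cong4_power_add[OF p4 p4, where h = "\<lambda>t. 100 - 96 * t + 64 * t ^ 2"])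
      (auto simp: algebra_simps power_numeral_reduce)
  have p12: "cong4 (\<lambda>t. p t ^ 12) (\<lambda>t. 1 - 12 * t + 66 * t ^ 2 - 232 * t ^ 3)"
    by (rule cong4_power_add[OF p8 p4, where h = "\<lambda>t. 488 - 608 * t + 512 * t ^ 2"])
      (auto simp: algebra_simps power_numeral_reduce)
  have p13: "cong4 (\<lambda>t. p t ^ 13) (\<lambda>t. 1 - 13 * t + 78 * t ^ 2 - 299 * t ^ 3)"
    by (rule cong4_power_add[OF p12 p1, where h = "\<lambda>t. 244 - 66 * t + 232 * t ^ 2"])
      (auto simp: algebra_simps power_numeral_reduce)
  have c: "cong4 (\<lambda>t. a * t ^ n) (\<lambda>t. a * t ^ n)" for a n
    by (rule cong4_refl) simp
  \<comment> \<open>The terms of \<open>cusp_poly\<close> with a factor below t^4. Monomials are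
    padded to the shape \<open>a * t ^ n\<close> so that \<open>c\<close> matches each of
    them.\<close>
  define main where "main = (\<lambda>t. p t ^ 13 * r t ^ 13 + (- 1) * t ^ 0 * r t ^ 14 + 13 * t ^ 1 * (p t ^ 2 * r t ^ 12)
    + (- 52) * t ^ 2 * (p t ^ 4 * r t ^ 10) + 78 * t ^ 3 * (p t ^ 6 * r t ^ 8))"
  have "cong4 main (\<lambda>t. (1 - 13 * t + 78 * t ^ 2 - 299 * t ^ 3) * 1 + (- 1) * t ^ 0 * 1 + 13 * t ^ 1 * ((1 - 2 * t + t ^ 2 - 2 * t ^ 3) * 1)
    + (- 52) * t ^ 2 * ((1 - 4 * t + 6 * t ^ 2 - 8 * t ^ 3) * 1) + 78 * t ^ 3 * ((1 - 6 * t + 15 * t ^ 2 - 26 * t ^ 3) * 1))"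
    unfolding main_def by (intro cong4_add cong4_mult[OF c] cong4_mult[OF _ rn] rn p13 p2 p4 p6)
  \<comment> \<open>The decisive cancellation, by degree: 1 - 1, -13 + 13, 78 - 26 - 52 and -299 +
    13 + 208 + 78.\<close>
  then have "cong4 main (\<lambda>_. 0)"
    by (rule cong4_trans[OF _ cong4I[where h = "\<lambda>t. - 806 + 1586 * t - 2028 * t ^ 2"]]) (auto simp: algebra_simps power_numeral_reduce)
  then have main: "main \<in> O[at 0](\<lambda>t. t ^ 4)"
    by (simp add: cong4_def)
  \<comment> \<open>The remaining terms divided by t^4; only their boundedness matters.\<close>
  define rest where "rest = (\<lambda>t. 64 * t ^ 3 * (p t ^ 1 * r t ^ 1) + 1 * t ^ 3 * (p t ^ 14 * r t ^ 0)
    + (- 13) * t ^ 2 * (p t ^ 12 * r t ^ 2) + 52 * t ^ 1 * (p t ^ 10 * r t ^ 4) + (- 78) * t ^ 0 * (p t ^ 8 * r t ^ 6))"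
  have "cong4 rest (\<lambda>t. 64 * t ^ 3 * ((1 - t - t ^ 3) ^ 1 * 1) + 1 * t ^ 3 * ((1 - t - t ^ 3) ^ 14 * 1)
    + (- 13) * t ^ 2 * ((1 - t - t ^ 3) ^ 12 * 1) + 52 * t ^ 1 * ((1 - t - t ^ 3) ^ 10 * 1)
    + (- 78) * t ^ 0 * ((1 - t - t ^ 3) ^ 8 * 1))"
    unfolding rest_def by (intro cong4_add cong4_mult[OF c] cong4_mult[OF _ rn] cong4_power[OF p])
  then have "rest \<in> O[at 0](\<lambda>_. 1)"
    by (simp add: cong4_def)
  from landau_o.big.mult[OF landau_o.big_refl this, of "\<lambda>t. t ^ 4"]
  have "(\<lambda>t. t ^ 4 * rest t) \<in> O[at 0](\<lambda>t. t ^ 4)"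
    by simp
  with main have "(\<lambda>t. main t + t ^ 4 * rest t) \<in> O[at 0](\<lambda>t. t ^ 4)"
    by (rule sum_in_bigo(1))
  moreover have "main t + t ^ 4 * rest t = cusp_poly t (p t) (r t)" for t
    unfolding main_def rest_def cusp_poly_def by (simp add: algebra_simps flip: power_add power_Suc)
  ultimately show ?thesis
    by simp
qed

text \<open>With v = q^(1/48) the Weber values are p/v and r/v^13. Hence y/x = r/(p s) and (x y)^6 =
  (p r)^6 / s^7 with s = v^12, and the seventh power of s p r clears all denominators, leaving only
  even powers of s.\<close>

lemma schlaefli_weber1_cusp:
  assumes \<tau>: "Im \<tau> > 0" and t: "t = e2pi (\<tau> / 2)" and s: "s = e2pi (\<tau> / 4)"
    and p: "p = qpoch_inf t (t\<^sup>2)" and r: "r = qpoch_inf (t ^ 13) ((t ^ 13)\<^sup>2)" and "p \<noteq> 0" "r \<noteq> 0"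
  shows "schlaefli 1 (weber1 \<tau>) (weber1 (13 * \<tau>)) * (s * p * r) ^ 7 = cusp_poly t p r"
proof -
  define v where "v = e2pi (\<tau> / 48)"
  have v0: "v \<noteq> 0" and s0: "s \<noteq> 0"
    by (simp_all add: v_def s)
  have sv: "s = v ^ 12"
    by (simp add: s v_def e2pi_power)
  have x: "weber1 \<tau> = p / v"
    by (simp add: weber1_def p t v_def e2pi_power e2pi_minus field_simps)
  have y: "weber1 (13 * \<tau>) = r / v ^ 13"
    by (simp add: weber1_def r t v_def e2pi_power e2pi_minus field_simps)
  have xy: "(weber1 \<tau> * weber1 (13 * \<tau>)) ^ 6 = (p * r) ^ 6 / s ^ 7"
  proof -
    have "weber1 \<tau> * weber1 (13 * \<tau>) = p * r / v ^ 14"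
      unfolding x y by (simp flip: power_Suc)
    then show ?thesis
      unfolding sv by (simp add: power_divide flip: power_mult)
  qed
  have yx: "weber1 (13 * \<tau>) / weber1 \<tau> = r / (p * s)"
  proof -
    have "v ^ 13 = v * v ^ 12"
      by (simp flip: power_Suc)
    then show ?thesis
      unfolding x y sv using v0 by simp
  qed
  have ts: "t = s\<^sup>2"
    by (simp add: t s e2pi_power)
  let ?M = "(s * p * r) ^ 7"
  have a0: "(p * r) ^ 6 / s ^ 7 * ?M = p ^ 13 * r ^ 13"
    using assms(6,7) s0 by (simp add: power_mult_distrib power_divide divide_simps power_numeral_reduce)
  have a1: "(64 / ((p * r) ^ 6 / s ^ 7)) * ?M = 64 * s ^ 14 * p * r"
    using assms(6,7) s0 by (simp add: power_mult_distrib power_divide divide_simps power_numeral_reduce)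
  have b7: "(r / (p * s)) ^ 7 * ?M = r ^ 14"
    using assms(6,7) s0 by (simp add: power_mult_distrib power_divide divide_simps power_numeral_reduce)
  have c7: "(1 / (r / (p * s))) ^ 7 * ?M = s ^ 14 * p ^ 14"
    using assms(6,7) s0 by (simp add: power_mult_distrib power_divide divide_simps power_numeral_reduce)
  have b5: "(r / (p * s)) ^ 5 * ?M = s ^ 2 * r ^ 12 * p ^ 2"
    using assms(6,7) s0 by (simp add: power_mult_distrib power_divide divide_simps power_numeral_reduce)
  have c5: "(1 / (r / (p * s))) ^ 5 * ?M = s ^ 12 * p ^ 12 * r ^ 2"
    using assms(6,7) s0 by (simp add: power_mult_distrib power_divide divide_simps power_numeral_reduce)
  have b3: "(r / (p * s)) ^ 3 * ?M = s ^ 4 * r ^ 10 * p ^ 4"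
    using assms(6,7) s0 by (simp add: power_mult_distrib power_divide divide_simps power_numeral_reduce)
  have c3: "(1 / (r / (p * s))) ^ 3 * ?M = s ^ 10 * p ^ 10 * r ^ 4"
    using assms(6,7) s0 by (simp add: power_mult_distrib power_divide divide_simps power_numeral_reduce)
  have b1: "(r / (p * s)) * ?M = s ^ 6 * r ^ 8 * p ^ 6"
    using assms(6,7) s0 by (simp add: power_mult_distrib power_divide divide_simps power_numeral_reduce)
  have c1: "1 / (r / (p * s)) * ?M = s ^ 8 * p ^ 8 * r ^ 6"
    using assms(6,7) s0 by (simp add: power_mult_distrib power_divide divide_simps power_numeral_reduce)
  have distr: "(A + A' - (B7 - C7 - 13 * (B5 - C5) + 52 * (B3 - C3) - 78 * (B1 - C1))) * M =
      A * M + A' * M - (B7 * M - C7 * M - 13 * (B5 * M - C5 * M) + 52 * (B3 * M - C3 * M) - 78 * (B1 * M - C1 * M))"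
    for A A' B7 C7 B5 C5 B3 C3 B1 C1 M :: complex
    by (simp add: algebra_simps)
  have "schlaefli 1 x y = (x * y) ^ 6 + 64 / (x * y) ^ 6 - odd_part (y / x)" for x y
    by (simp add: schlaefli_def)
  then show ?thesis
    unfolding odd_part_def cusp_poly_def
    by (simp only: xy yx ts distr a0 a1 b7 c7 b5 c5 b3 c3 b1 c1) (simp flip: power_mult)
qed

lemma isCont_qpoch_inf_power: "isCont (\<lambda>t::complex. qpoch_inf (t ^ Suc m) (t ^ Suc n)) 0"
proof -
  have "(\<lambda>t. qpoch_inf (t ^ Suc m) (t ^ Suc n)) holomorphic_on ball 0 1"
    by (intro holomorphic_qpoch_inf holomorphic_intros)
      (auto simp: norm_power power_less_one_iff simp del: power_Suc)
  then show ?thesis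
    by (meson centre_in_ball continuous_on_eq_continuous_at holomorphic_on_imp_continuous_on open_ball zero_less_one)
qed

lemma cong4_qpoch_inf_one: "cong4 (\<lambda>t. qpoch_inf (t ^ (4 + m)) (t ^ Suc n)) (\<lambda>_. 1)"
proof -
  have "\<forall>\<^sub>F t in at 0. norm (qpoch_inf (t ^ (4 + m)) (t ^ Suc n) - 1) \<le> 4 * norm (t ^ 4)"
  proof -
    have "norm (qpoch_inf (t ^ (4 + m)) (t ^ Suc n) - 1) \<le> 4 * norm (t ^ 4)" if t: "norm t < 1 / 2" for t :: complex
    proof -
      have le: "norm t ^ k \<le> 1" for k
        using t by (intro power_le_one) auto
      have "norm (t ^ Suc n) \<le> (1 / 2) * 1"
        using t le[of n] by (subst norm_power, subst power_Suc, intro mult_mono) auto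
      moreover have "norm (t ^ (4 + m)) \<le> norm (t ^ 4)"
        using mult_left_le[OF le[of m], of "norm t ^ 4"] by (simp add: norm_mult norm_power power_add)
      moreover have "norm (t ^ 4) \<le> (1 / 2) * 1"
        unfolding norm_power using mult_mono[of "norm t" "1 / 2" "norm t ^ 3" 1] t le[of 3]
        by (simp flip: power_Suc)
      ultimately show ?thesis
        using norm_qpoch_inf_minus_1_le[of "t ^ Suc n" "t ^ (4 + m)"] by linarith
    qed
    then show ?thesis
      unfolding eventually_at by (intro exI[of _ "1 / 2"]) auto
  qed
  then have "(\<lambda>t. qpoch_inf (t ^ (4 + m)) (t ^ Suc n) - 1) \<in> O[at 0](\<lambda>t. t ^ 4)"
    by (intro bigoI[of _ 4]) auto
  moreover have "isCont (\<lambda>t::complex. qpoch_inf (t ^ (4 + m)) (t ^ Suc n)) 0"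
    using isCont_qpoch_inf_power[of "3 + m" n] by simp
  ultimately show ?thesis
    by (simp add: cong4_def bigo_1_isCont)
qed

lemma cong4_eventually_cong:
  assumes "cong4 f g" "\<forall>\<^sub>F t in at 0. f' t = f t"
  shows "cong4 f' g"
proof -
  have "\<forall>\<^sub>F t in at 0. f' t - g t = f t - g t"
    using assms(2) by eventually_elim simp
  from landau_o.big.in_cong[OF this] landau_o.big.in_cong[OF assms(2)] show ?thesis
    using assms(1) by (simp add: cong4_def)
qed

text \<open>The factors are 1 - t^(2n+1); only the first two matter modulo t^4, the rest starting at
  t^5.\<close>

lemma cong4_weber1_product: "cong4 (\<lambda>t. qpoch_inf t (t\<^sup>2)) (\<lambda>t. 1 - t - t ^ 3)"
proof -
  have "cong4 (\<lambda>t. (1 - t) * (1 - t ^ 3)) (\<lambda>t. 1 - t - t ^ 3)"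
    by (rule cong4I[where h = "\<lambda>_. 1"]) (auto simp: algebra_simps power_numeral_reduce)
  from cong4_mult[OF this cong4_qpoch_inf_one[of 1 1]]
  have "cong4 (\<lambda>t. (1 - t) * (1 - t ^ 3) * qpoch_inf (t ^ 5) (t\<^sup>2)) (\<lambda>t. 1 - t - t ^ 3)"
    by (simp add: numeral_2_eq_2)
  moreover have "qpoch_inf t (t\<^sup>2) = (1 - t) * (1 - t ^ 3) * qpoch_inf (t ^ 5) (t\<^sup>2)" if "norm t < 1" for t :: complex
  proof -
    have t2: "norm (t\<^sup>2) < 1"
      using that by (simp add: norm_power power_less_one_iff)
    have "qpoch_inf t (t\<^sup>2) = (1 - t) * ((1 - t ^ 3) * qpoch_inf (t ^ 3 * t\<^sup>2) (t\<^sup>2))"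
      using qpoch_inf_rec[OF t2, of t] qpoch_inf_rec[OF t2, of "t ^ 3"] by (simp flip: power_Suc)
    then show ?thesis
      by (simp flip: power_add)
  qed
  then have "\<forall>\<^sub>F t in at 0. qpoch_inf t (t\<^sup>2) = (1 - t) * (1 - t ^ 3) * qpoch_inf (t ^ 5) (t\<^sup>2)"
    unfolding eventually_at by (intro exI[of _ 1]) auto
  ultimately show ?thesis
    by (rule cong4_eventually_cong)
qed

text \<open>The numerator is O(t^4) = O(s^8) against a denominator of order s^7, so the norm is at
  most a constant times |s|.\<close>

lemma schlaefli_norm_cusp:
  assumes "\<epsilon> > 0"
  obtains Y where "\<And>\<tau>. Im \<tau> > Y \<Longrightarrow> Im \<tau> > 0 \<Longrightarrow> schlaefli_norm 1 \<tau> < \<epsilon>"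
proof -
  define p where "p = (\<lambda>t::complex. qpoch_inf t (t\<^sup>2))"
  define r where "r = (\<lambda>t::complex. qpoch_inf (t ^ 13) ((t ^ 13)\<^sup>2))"
  have "cong4 r (\<lambda>_. 1)"
    unfolding r_def using cong4_qpoch_inf_one[of 9 25] by (simp flip: power_mult)
  then have "(\<lambda>t. cusp_poly t (p t) (r t)) \<in> O[at 0](\<lambda>t. t ^ 4)"
    by (intro cong4_cusp_poly) (simp_all add: p_def cong4_weber1_product)
  then obtain C where C: "C > 0" "\<forall>\<^sub>F t in at 0. norm (cusp_poly t (p t) (r t)) \<le> C * norm (t ^ 4)"
    by (rule landau_o.bigE)
  then obtain \<delta> where \<delta>: "\<delta> > 0"
    "\<And>t. t \<noteq> 0 \<Longrightarrow> norm t < \<delta> \<Longrightarrow> norm (cusp_poly t (p t) (r t)) \<le> C * norm (t ^ 4)"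
    unfolding eventually_at by auto
  \<comment> \<open>2^14 = 4^7 comes from the bound |p r| >= 1/4, raised to the seventh
    power.\<close>
  define K where "K = 2 ^ 14 * C"
  have K: "K > 0"
    using C by (simp add: K_def)
  \<comment> \<open>The bound 1/8 keeps p and r within 4 * 1/8 = 1/2 of 1.\<close>
  define m where "m = min (min \<delta> (1 / 8)) (\<epsilon> / K)"
  have m: "m > 0" "m \<le> \<delta>" "m \<le> 1 / 8" "m \<le> \<epsilon> / K"
    using \<delta>(1) K assms unfolding m_def by (simp, linarith+)
  \<comment> \<open>Since |s| = exp(-(pi/2) Im \<tau>), this height is where |s| drops below
    \<open>m\<close>.\<close>
  show thesis
  proof (rule that[of "- (2 / pi) * ln m"])
    fix \<tau> assume Y: "Im \<tau> > - (2 / pi) * ln m" and \<tau>: "Im \<tau> > 0"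
    define s where "s = e2pi (\<tau> / 4)"
    define t where "t = e2pi (\<tau> / 2)"
    have ts: "t = s\<^sup>2"
      by (simp add: t_def s_def e2pi_power)
    have "- (pi / 2 * Im \<tau>) < ln m"
      using Y by (simp add: field_simps)
    then have "exp (- (pi / 2 * Im \<tau>)) < m"
      using m(1) by (metis exp_less_cancel_iff exp_ln)
    then have sm: "norm s < m"
      by (simp add: s_def norm_e2pi field_simps)
    have "norm t = norm s * norm s"
      by (simp add: ts norm_power power2_eq_square norm_mult)
    also have "\<dots> \<le> norm s * 1"
      using sm m by (intro mult_left_mono) auto
    finally have tm: "norm t < m" "norm t \<le> 1 / 8"
      using sm m by auto
    have s0: "s \<noteq> 0" and t0: "t \<noteq> 0"
      by (simp_all add: s_def t_def)
    have le: "norm (t ^ Suc k) \<le> 1 / 8" for k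
    proof -
      have "norm (t ^ Suc k) \<le> (1 / 8) * 1"
        using tm by (subst norm_power, subst power_Suc, intro mult_mono power_le_one) auto
      then show ?thesis
        by simp
    qed
    have half: "norm (qpoch_inf (t ^ Suc k) (t ^ Suc l)) \<ge> 1 / 2" for k l
    proof -
      have "norm (qpoch_inf (t ^ Suc k) (t ^ Suc l) - 1) \<le> 4 * norm (t ^ Suc k)"
        using le[of k] le[of l] by (intro norm_qpoch_inf_minus_1_le) linarith+
      then have "norm (qpoch_inf (t ^ Suc k) (t ^ Suc l) - 1) \<le> 1 / 2"
        using le[of k] by linarith
      moreover have "norm (1 :: complex) \<le> norm (qpoch_inf (t ^ Suc k) (t ^ Suc l)) + norm (qpoch_inf (t ^ Suc k) (t ^ Suc l) - 1)"
        by (metis norm_minus_commute norm_triangle_sub)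
      ultimately show ?thesis
        by simp
    qed
    have ph: "norm (p t) \<ge> 1 / 2"
      using half[of 0 1] by (simp add: p_def numeral_2_eq_2)
    have rh: "norm (r t) \<ge> 1 / 2"
      using half[of 12 25] unfolding r_def by (simp flip: power_mult)
    have nz: "p t \<noteq> 0" "r t \<noteq> 0"
      using ph rh by auto
    define F where "F = schlaefli 1 (weber1 \<tau>) (weber1 (13 * \<tau>))"
    have eq: "F * (s * p t * r t) ^ 7 = cusp_poly t (p t) (r t)"
      unfolding F_def by (rule schlaefli_weber1_cusp[OF \<tau> t_def s_def]) (use nz in \<open>simp_all add: p_def r_def\<close>)
    have "(1 / 2) * (1 / 2) \<le> norm (p t) * norm (r t)"
      using ph rh by (intro mult_mono) auto
    then have "(1 / 4) ^ 7 \<le> (norm (p t) * norm (r t)) ^ 7"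
      by (intro power_mono) auto
    then have "norm F * (norm s ^ 7 * (1 / 4) ^ 7) \<le> norm F * (norm s ^ 7 * (norm (p t) * norm (r t)) ^ 7)"
      by (intro mult_left_mono) auto
    also have "\<dots> = norm (F * (s * p t * r t) ^ 7)"
      by (simp add: norm_mult norm_power power_mult_distrib mult_ac)
    also have "\<dots> \<le> C * norm (t ^ 4)"
      unfolding eq using \<delta>(2)[OF t0] tm m by simp
    also have "norm (t ^ 4) = norm s ^ 7 * norm s"
      by (simp add: ts norm_power flip: power_mult power_Suc2)
    finally have "norm F * (1 / 4) ^ 7 \<le> C * norm s"
      using s0 by (simp add: mult.left_commute)
    then have "norm F \<le> K * norm s"
      by (simp add: K_def power_divide field_simps)
    also have "\<dots> < K * m"
      using K sm by simp
    also have "\<dots> \<le> \<epsilon>"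
      using K m(4) by (simp add: field_simps)
    finally show "schlaefli_norm 1 \<tau> < \<epsilon>"
      by (simp add: schlaefli_norm_def weber_def F_def)
  qed
qed

subsection \<open>The modular equation\<close>

lemma holomorphic_schlaefli_weber1:
  "(\<lambda>\<tau>. schlaefli 1 (weber1 \<tau>) (weber1 (13 * \<tau>))) holomorphic_on {\<tau>. Im \<tau> > 0}"
proof -
  have "weber1 \<circ> (\<lambda>\<tau>. 13 * \<tau>) holomorphic_on {\<tau>. Im \<tau> > 0}"
    by (intro holomorphic_on_compose_gen[OF _ holomorphic_weber1] holomorphic_intros) auto
  then have w13: "(\<lambda>\<tau>. weber1 (13 * \<tau>)) holomorphic_on {\<tau>. Im \<tau> > 0}"
    by (simp add: o_def)
  show ?thesis
    unfolding schlaefli_def odd_part_def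
    by simp (intro holomorphic_intros w13 holomorphic_weber1, auto simp: weber1_nonzero)
qed

lemma weber1_modular_equation:
  assumes \<tau>1: "Im \<tau>1 > 0"
  shows "schlaefli 1 (weber1 \<tau>1) (weber1 (13 * \<tau>1)) = 0"
proof (rule ccontr)
  define F where "F = (\<lambda>\<tau>. schlaefli 1 (weber1 \<tau>) (weber1 (13 * \<tau>)))"
  have F: "schlaefli_norm 1 \<tau> = norm (F \<tau>)" for \<tau>
    by (simp add: schlaefli_norm_def weber_def F_def)
  have hol: "F holomorphic_on {\<tau>. Im \<tau> > 0}"
    unfolding F_def by (rule holomorphic_schlaefli_weber1)
  assume "schlaefli 1 (weber1 \<tau>1) (weber1 (13 * \<tau>1)) \<noteq> 0"
  then have F1: "norm (F \<tau>1) > 0"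
    by (simp add: F_def)
  then obtain Y where Y: "\<And>\<tau>. Im \<tau> > Y \<Longrightarrow> Im \<tau> > 0 \<Longrightarrow> norm (F \<tau>) < norm (F \<tau>1)"
    using schlaefli_norm_cusp unfolding F by metis
  \<comment> \<open>Points above \<open>Y\<close> have values below that at \<open>\<tau>1\<close>
    and cannot compete for the maximum; \<open>max Y 1\<close> makes \<open>\<i>\<close> a member of
    the box.\<close>
  let ?K = "cbox (Complex (- 1) (1 / 26)) (Complex 1 (max Y 1))"
  have sub: "?K \<subseteq> {\<tau>. Im \<tau> > 0}"
    by (auto simp: in_cbox_complex_iff)
  have "continuous_on ?K (\<lambda>\<tau>. norm (F \<tau>))"
    by (intro continuous_intros holomorphic_on_imp_continuous_on holomorphic_on_subset[OF hol sub])
  moreover have "\<i> \<in> ?K"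
    by (auto simp: in_cbox_complex_iff)
  ultimately obtain z0 where z0: "z0 \<in> ?K" "\<And>z. z \<in> ?K \<Longrightarrow> norm (F z) \<le> norm (F z0)"
    using continuous_attains_sup[of ?K "\<lambda>\<tau>. norm (F \<tau>)"] compact_cbox by blast
  have *: "norm (F z) < norm (F \<tau>1) \<or> norm (F z) \<le> norm (F z0)" if z: "Im z > 0" for z
  proof -
    obtain w where w: "Im w \<ge> 1 / 26" "\<bar>Re w\<bar> \<le> 1" "norm (F z) = norm (F w)"
      using schlaefli_norm_reduction[OF z] unfolding F by metis
    show ?thesis
    proof (cases "Im w > Y")
      case True
      then show ?thesis
        using Y[of w] w by simp
    next
      case False
      then have "w \<in> ?K"
        using w by (auto simp: in_cbox_complex_iff)
      then show ?thesis
        using z0(2) w(3) by simp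
    qed
  qed
  have 1: "norm (F \<tau>1) \<le> norm (F z0)"
    using *[OF \<tau>1] by simp
  have max: "norm (F z) \<le> norm (F z0)" if "Im z > 0" for z
    using *[OF that] 1 by linarith
  have "F constant_on {\<tau>. Im \<tau> > 0}"
    by (rule maximum_modulus_principle[OF hol open_upper_half_plane connected_upper_half_plane
          open_upper_half_plane order.refl, of z0]) (use z0 sub max in auto)
  \<comment> \<open>A point above \<open>Y\<close> contradicts constancy, as its value is strictly
    smaller in norm than the nonzero value at \<open>\<tau>1\<close>.\<close>
  then have "F (Complex 0 (max Y 1 + 1)) = F \<tau>1"
    using \<tau>1 unfolding constant_on_def by force
  then show False
    using Y[of "Complex 0 (max Y 1 + 1)"] by (simp add: max_def split: if_splits)
qed

text \<open>Splitting (q;q) by parity cancels (q^2;q^2) and leaves (q;q^2), the product in f1 at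
  2\<tau>.\<close>

lemma ramanujan_f_quotient:
  assumes "Im \<tau> > 0"
  shows "ramanujan_f (- e2pi \<tau>) / (e2pi (\<tau> / 24) * ramanujan_f (- (e2pi \<tau> ^ 2))) = weber1 (2 * \<tau>)"
proof -
  note q = norm_e2pi_less_1[OF assms]
  have q2: "norm (e2pi \<tau> ^ 2) < 1"
    using q by (simp add: norm_power power_less_one_iff)
  have "qpoch_inf (e2pi \<tau>) (e2pi \<tau>) =
      qpoch_inf (e2pi \<tau>) (e2pi \<tau> ^ 2) * qpoch_inf (e2pi \<tau> ^ 2) (e2pi \<tau> ^ 2)"
    using qpoch_inf_even_odd[OF q, of "e2pi \<tau>"] by (simp add: power2_eq_square)
  moreover have "weber1 (2 * \<tau>) = inverse (e2pi (\<tau> / 24)) * qpoch_inf (e2pi \<tau>) (e2pi \<tau> ^ 2)"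
    by (simp add: weber1_def e2pi_power flip: e2pi_minus)
  ultimately show ?thesis
    using qpoch_inf_nonzero'[OF q2 q2] by (simp add: ramanujan_f_def field_simps)
qed

theorem theorem3p6:
  fixes \<tau> q P Q :: complex
  assumes "Im \<tau> > 0"
    and "q = exp (2 * of_real pi * \<i> * \<tau>)"
    and "P = ramanujan_f (- q) / (nome_pow \<tau> (1 / 24) * ramanujan_f (- (q ^ 2)))"
    and "Q = ramanujan_f (- (q ^ 13)) / (nome_pow \<tau> (13 / 24) * ramanujan_f (- (q ^ 26)))"
  shows "(P * Q) ^ 6 + (2 / (P * Q)) ^ 6 =
           (Q / P) ^ 7 - (P / Q) ^ 7
           - 13 * ((Q / P) ^ 5 - (P / Q) ^ 5)
           + 52 * ((Q / P) ^ 3 - (P / Q) ^ 3)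
           - 78 * (Q / P - P / Q)"
proof -
  have q: "q = e2pi \<tau>"
    by (simp add: assms(2) e2pi_def)
  have nome: "nome_pow \<tau> r = e2pi (of_real r * \<tau>)" for r
    by (simp add: nome_pow_def e2pi_def mult.assoc)
  have P: "P = weber1 (2 * \<tau>)"
    using ramanujan_f_quotient[OF assms(1)] by (simp add: assms(3) q nome)
  \<comment> \<open>The same quotient at 13\<tau>, whose nome is q^13.\<close>
  have Q: "Q = weber1 (13 * (2 * \<tau>))"
    using ramanujan_f_quotient[of "13 * \<tau>"] assms(1) by (simp add: assms(4) q nome e2pi_power)
  have "Im (2 * \<tau>) > 0"
    using assms(1) by simp
  from weber1_modular_equation[OF this] show ?thesis
    unfolding P[symmetric] Q[symmetric] schlaefli_def odd_part_def by (simp add: power_divide)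
qed

end
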